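(* Let $\mu=(\mu_1,\dots,\mu_d)'$ be the vector of market weights, $A\in CBV([0,T],\mathbb{R}^m)$, and let $G:\mathbb{R}^d\times\mathbb{R}^m\to\mathbb{R}$ be a regular function for the pair $(\mu,A)$ such that $1/G(\mu(\cdot),A(\cdot))$ is locally bounded. Let $\psi=(\psi_1,\dots,\psi_d)'$ be the trading strategy multiplicatively generated by $G$. Then its value $V^\psi(t)=\sum_{i=1}^d\psi_i(t)\mu_i(t)$ is $$V^\psi(t)=G(\mu(t),A(t))\exp\Big(\int_0^t\frac{d\Gamma^G(s)}{G(\mu(s),A(s))}\Big)>0,\qquad 0\le t\le T,$$ and for $i=1,\dots,d$ and $0\le t\le T$, $$\psi_i(t)=V^\psi(t)\bigg(1+\frac{1}{G(\mu(t),A(t))}\Big(\partial_iG(\mu(t),A(t))-\sum_{j=1}^d\mu_j(t)\,\partial_jG(\mu(t),A(t))\Big)\bigg).$$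
   Context: Partitions: $T>0$ is fixed, and $(\mathbb{T}_n)_{n\in\mathbb{N}}$ is a fixed sequence of finite partitions of $[0,T]$ (containing $0$ and $T$) with $\mathbb{T}_1\subset\mathbb{T}_2\subset\cdots$ and mesh tending to $0$. $[t_j,t_{j+1}]\in\mathbb{T}_n$ means that $t_j<t_{j+1}$ are consecutive points of $\mathbb{T}_n$; in sums over $[t_j,t_{j+1}]\in\mathbb{T}_n$ with $t_j\le t$, $t_{j+1}$ is replaced by $t$ when $j$ is the largest index with $t_j\le t$. Market weights: $S_1,\dots,S_d:[0,T]\to[0,\infty)$ ($d\ge2$) are continuous with $S_i(0)>0$ and $S_1(t)+\dots+S_d(t)>0$ for all $t$; $\mu_i(t)=S_i(t)/(S_1(t)+\dots+S_d(t))$. It is assumed that $\mu$ has pathwise quadratic covariations along $(\mathbb{T}_n)$: for all $i,k$ and $t$ the limit $\langle\mu_i,\mu_k\rangle(t)=\lim_n\sum_{[t_j,t_{j+1}]\in\mathbb{T}_n,\,t_j\le t}(\mu_i(t_{j+1})-\mu_i(t_j))(\mu_k(t_{j+1})-\mu_k(t_j))$ exists and is real-valued and continuous in $t$. $CBV([0,T],\mathbb{R}^m)$: continuous $\mathbb{R}^m$-valued functions of bounded variation on $[0,T]$. $\mathbb{C}^{2,1}$: functions on $\mathbb{R}^{d+m}$ twice continuously differentiable in the first $d$ variables and once continuously differentiable in the last $m$ variables; $\partial_i$ denotes the derivative in the $i$-th of the first $d$ variables. Integral: for integrands $\theta=(\theta_1,\dots,\theta_d)$ below, $\int_0^t\sum_{i=1}^d\theta_i(s)\,d\mu_i(s):=\lim_{n}\sum_{[t_j,t_{j+1}]\in\mathbb{T}_n,\,t_j\le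 t}\sum_{i=1}^d\theta_i(t_j)(\mu_i(t_{j+1})-\mu_i(t_j))$ (the limits needed here exist by the pathwise Itô formula). Regular function: $G\in\mathbb{C}^{2,1}$ is regular for $(\mu,A)$ if $\Gamma^G(t):=G(\mu(0),A(0))-G(\mu(t),A(t))+\int_0^t\sum_i\partial_iG(\mu(s),A(s))\,d\mu_i(s)$, $0\le t\le T$, has finite variation on compact intervals of $[0,T]$. Multiplicative generation: put $\eta_i(t)=\partial_iG(\mu(t),A(t))\exp\big(\int_0^t\frac{d\Gamma^G(s)}{G(\mu(s),A(s))}\big)$ (Lebesgue–Stieltjes integral in the exponent), $V^\eta(t)=\sum_i\eta_i(t)\mu_i(t)$, $Q^\eta(t)=V^\eta(t)-V^\eta(0)-\int_0^t\sum_i\eta_i(s)\,d\mu_i(s)$, and $C(0)=\sum_i\partial_iG(\mu(0),A(0))\mu_i(0)-G(\mu(0),A(0))$. The trading strategy multiplicatively generated by $G$ is $\psi_i(t)=\eta_i(t)-Q^\eta(t)-C(0)$, $i=1,\dots,d$.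
   Formalization: The positivity of the value is claimed only when G(μ(0),A(0)) > 0, since it fails for G ≡ −1, where the value is −1; both formulas are proved without a sign condition, and 1/G locally bounded is read as including that G(μ(t),A(t)) is nonzero on [0,T]. *)

theory Defs
  imports "HOL-Analysis.Analysis"
begin

section \<open>Partitions\<close>

text \<open>A finite partition is represented by the set \<open>D\<close> of its points; \<open>cells D\<close> is the set of
  pairs of consecutive points.\<close>

definition cells :: "real set \<Rightarrow> (real \<times> real) set" where
  "cells D = {(s, u). s \<in> D \<and> u \<in> D \<and> s < u \<and> D \<inter> {s<..<u} = {}}"

definition mesh :: "real set \<Rightarrow> real" where
  "mesh D = Max ((\<lambda>(s, u). u - s) ` cells D)"

definition refining_partitions :: "real \<Rightarrow> (nat \<Rightarrow> real set) \<Rightarrow> bool" where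
  "refining_partitions T P \<longleftrightarrow>
     (\<forall>n. finite (P n) \<and> {0, T} \<subseteq> P n \<and> P n \<subseteq> {0..T}) \<and> incseq P \<and>
     (\<lambda>n. mesh (P n)) \<longlonglongrightarrow> 0"

text \<open>For \<open>s \<le> t\<close> the point \<open>min u t\<close> differs from \<open>u\<close> only if \<open>s\<close> is the largest partition point
  \<open>\<le> t\<close>, in which case the right end point of the cell is replaced by \<open>t\<close>.\<close>

definition covariation_sum ::
    "real set \<Rightarrow> (real \<Rightarrow> real) \<Rightarrow> (real \<Rightarrow> real) \<Rightarrow> real \<Rightarrow> real" where
  "covariation_sum D X Y t =
     (\<Sum>(s, u) \<in> {(s, u) \<in> cells D. s \<le> t}. (X (min u t) - X s) * (Y (min u t) - Y s))"

definition covariation ::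
    "(nat \<Rightarrow> real set) \<Rightarrow> (real \<Rightarrow> real) \<Rightarrow> (real \<Rightarrow> real) \<Rightarrow> real \<Rightarrow> real" where
  "covariation P X Y t = lim (\<lambda>n. covariation_sum (P n) X Y t)"

definition has_covariations ::
    "real \<Rightarrow> (nat \<Rightarrow> real set) \<Rightarrow> (real \<Rightarrow> real^'d) \<Rightarrow> bool" where
  "has_covariations T P X \<longleftrightarrow> (\<forall>i k.
     (\<forall>t\<in>{0..T}. convergent (\<lambda>n. covariation_sum (P n) (\<lambda>s. X s $ i) (\<lambda>s. X s $ k) t)) \<and>
     continuous_on {0..T} (covariation P (\<lambda>s. X s $ i) (\<lambda>s. X s $ k)))"

definition pathwise_integral ::
    "(nat \<Rightarrow> real set) \<Rightarrow> (real \<Rightarrow> real^'d) \<Rightarrow> (real \<Rightarrow> real^'d) \<Rightarrow> real \<Rightarrow> real" where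
  "pathwise_integral P \<theta> X t =
     lim (\<lambda>n. \<Sum>(s, u) \<in> {(s, u) \<in> cells (P n). s \<le> t}.
                \<Sum>i\<in>UNIV. \<theta> s $ i * (X (min u t) $ i - X s $ i))"


section \<open>Bounded variation and Lebesgue-Stieltjes integrals\<close>

definition variation_sums :: "real set \<Rightarrow> (real \<Rightarrow> 'a::real_normed_vector) \<Rightarrow> real set" where
  "variation_sums I F =
     {(\<Sum>(s, u) \<in> cells D. norm (F u - F s)) | D. finite D \<and> D \<subseteq> I}"

definition bounded_variation_on :: "real set \<Rightarrow> (real \<Rightarrow> 'a::real_normed_vector) \<Rightarrow> bool" where
  "bounded_variation_on I F \<longleftrightarrow> bdd_above (variation_sums I F)"

definition total_variation :: "real set \<Rightarrow> (real \<Rightarrow> 'a::real_normed_vector) \<Rightarrow> real" where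
  "total_variation I F = Sup (variation_sums I F)"

definition CBV :: "real \<Rightarrow> (real \<Rightarrow> 'a::real_normed_vector) set" where
  "CBV T = {F. continuous_on {0..T} F \<and> bounded_variation_on {0..T} F}"

definition positive_variation :: "(real \<Rightarrow> real) \<Rightarrow> real \<Rightarrow> real" where
  "positive_variation F s = (total_variation {0..s} F + (F s - F 0)) / 2"

definition negative_variation :: "(real \<Rightarrow> real) \<Rightarrow> real \<Rightarrow> real" where
  "negative_variation F s = (total_variation {0..s} F - (F s - F 0)) / 2"

text \<open>\<open>interval_measure\<close> expects a nondecreasing right-continuous function on the whole line, so the
  two parts of the Jordan decomposition of \<open>F\<close> on \<open>[0, t]\<close> are extended by constants.\<close>

definition extend_const :: "real \<Rightarrow> (real \<Rightarrow> real) \<Rightarrow> real \<Rightarrow> real" where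
  "extend_const t F s = F (max 0 (min t s))"

definition stieltjes_integral :: "(real \<Rightarrow> real) \<Rightarrow> (real \<Rightarrow> real) \<Rightarrow> real \<Rightarrow> real" where
  "stieltjes_integral g F t =
     (LINT s:{0<..t}|interval_measure (extend_const t (positive_variation F)). g s) -
     (LINT s:{0<..t}|interval_measure (extend_const t (negative_variation F)). g s)"


section \<open>Functions of class C(2,1)\<close>

definition dir_deriv :: "'a::real_normed_vector \<Rightarrow> ('a \<Rightarrow> real) \<Rightarrow> 'a \<Rightarrow> real" where
  "dir_deriv v G z = deriv (\<lambda>h. G (z + h *\<^sub>R v)) 0"

definition has_cont_dir_deriv :: "'a::real_normed_vector \<Rightarrow> ('a \<Rightarrow> real) \<Rightarrow> bool" where
  "has_cont_dir_deriv v G \<longleftrightarrow>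
     (\<forall>z. (\<lambda>h. G (z + h *\<^sub>R v)) field_differentiable at 0) \<and> continuous_on UNIV (dir_deriv v G)"

abbreviation unit_x :: "'d::finite \<Rightarrow> (real^'d) \<times> (real^'m)" where
  "unit_x i \<equiv> (axis i 1, 0)"

abbreviation unit_a :: "'m::finite \<Rightarrow> (real^'d) \<times> (real^'m)" where
  "unit_a k \<equiv> (0, axis k 1)"

abbreviation partial_x ::
    "'d::finite \<Rightarrow> ((real^'d) \<times> (real^'m) \<Rightarrow> real) \<Rightarrow> (real^'d) \<times> (real^'m) \<Rightarrow> real" where
  "partial_x i \<equiv> dir_deriv (unit_x i)"

definition C21 :: "((real^'d) \<times> (real^'m) \<Rightarrow> real) \<Rightarrow> bool" where
  "C21 G \<longleftrightarrow> continuous_on UNIV G \<and>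
     (\<forall>i. has_cont_dir_deriv (unit_x i) G) \<and>
     (\<forall>i j. has_cont_dir_deriv (unit_x j) (partial_x i G)) \<and>
     (\<forall>k. has_cont_dir_deriv (unit_a k) G)"


section \<open>Regular functions and multiplicative generation\<close>

definition Gamma_proc ::
    "(nat \<Rightarrow> real set) \<Rightarrow> (real \<Rightarrow> real^'d) \<Rightarrow> (real \<Rightarrow> real^'m) \<Rightarrow>
     ((real^'d) \<times> (real^'m) \<Rightarrow> real) \<Rightarrow> real \<Rightarrow> real" where
  "Gamma_proc P \<mu> A G t =
     G (\<mu> 0, A 0) - G (\<mu> t, A t) +
     pathwise_integral P (\<lambda>s. \<chi> i. partial_x i G (\<mu> s, A s)) \<mu> t"

definition regular_for ::
    "real \<Rightarrow> (nat \<Rightarrow> real set) \<Rightarrow> (real \<Rightarrow> real^'d) \<Rightarrow> (real \<Rightarrow> real^'m) \<Rightarrow>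
     ((real^'d) \<times> (real^'m) \<Rightarrow> real) \<Rightarrow> bool" where
  "regular_for T P \<mu> A G \<longleftrightarrow> C21 G \<and>
     (\<forall>a b. {a..b} \<subseteq> {0..T} \<longrightarrow> bounded_variation_on {a..b} (Gamma_proc P \<mu> A G))"

definition locally_bounded_on :: "real set \<Rightarrow> (real \<Rightarrow> real) \<Rightarrow> bool" where
  "locally_bounded_on I f \<longleftrightarrow> (\<forall>t\<in>I. \<exists>U. open U \<and> t \<in> U \<and> bounded (f ` (U \<inter> I)))"

definition gen_exp ::
    "(nat \<Rightarrow> real set) \<Rightarrow> (real \<Rightarrow> real^'d) \<Rightarrow> (real \<Rightarrow> real^'m) \<Rightarrow>
     ((real^'d) \<times> (real^'m) \<Rightarrow> real) \<Rightarrow> real \<Rightarrow> real" where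
  "gen_exp P \<mu> A G t = exp (stieltjes_integral (\<lambda>s. 1 / G (\<mu> s, A s)) (Gamma_proc P \<mu> A G) t)"

definition gen_eta ::
    "(nat \<Rightarrow> real set) \<Rightarrow> (real \<Rightarrow> real^'d) \<Rightarrow> (real \<Rightarrow> real^'m) \<Rightarrow>
     ((real^'d) \<times> (real^'m) \<Rightarrow> real) \<Rightarrow> real \<Rightarrow> real^'d" where
  "gen_eta P \<mu> A G t = (\<chi> i. partial_x i G (\<mu> t, A t) * gen_exp P \<mu> A G t)"

definition strategy_value :: "(real \<Rightarrow> real^'d) \<Rightarrow> (real \<Rightarrow> real^'d) \<Rightarrow> real \<Rightarrow> real" where
  "strategy_value \<theta> \<mu> t = (\<Sum>i\<in>UNIV. \<theta> t $ i * \<mu> t $ i)"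

definition sf_defect ::
    "(nat \<Rightarrow> real set) \<Rightarrow> (real \<Rightarrow> real^'d) \<Rightarrow> (real \<Rightarrow> real^'d) \<Rightarrow> real \<Rightarrow> real" where
  "sf_defect P \<theta> \<mu> t =
     strategy_value \<theta> \<mu> t - strategy_value \<theta> \<mu> 0 - pathwise_integral P \<theta> \<mu> t"

definition gen_const ::
    "(real \<Rightarrow> real^'d) \<Rightarrow> (real \<Rightarrow> real^'m) \<Rightarrow> ((real^'d) \<times> (real^'m) \<Rightarrow> real) \<Rightarrow> real" where
  "gen_const \<mu> A G = (\<Sum>i\<in>UNIV. partial_x i G (\<mu> 0, A 0) * \<mu> 0 $ i) - G (\<mu> 0, A 0)"

definition mult_generated ::
    "(nat \<Rightarrow> real set) \<Rightarrow> (real \<Rightarrow> real^'d) \<Rightarrow> (real \<Rightarrow> real^'m) \<Rightarrow>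
     ((real^'d) \<times> (real^'m) \<Rightarrow> real) \<Rightarrow> real \<Rightarrow> real^'d" where
  "mult_generated P \<mu> A G t =
     (\<chi> i. gen_eta P \<mu> A G t $ i - sf_defect P (gen_eta P \<mu> A G) \<mu> t - gen_const \<mu> A G)"

end

theory Submission
  imports Defs
begin

text \<open>Write \<open>E = exp (\<integral> d\<Gamma> / G)\<close>. The key identity is
  \<open>\<integral>\<^sub>0\<^sup>t E \<nabla>G d\<mu> = G E (t) - G (0)\<close>; since the weights sum to 1, the two formulas follow from it
  by algebra. With the Taylor remainder \<open>R = \<Delta>G - \<nabla>G \<Delta>\<mu>\<close> on a partition cell, the identity
  \<open>\<Delta>(G E) = E \<nabla>G \<Delta>\<mu> + E R + G \<Delta>E\<close> reduces it to two limits. The sums of \<open>E R\<close> converge to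
  \<open>- \<integral> E d\<Gamma>\<close>, because by the pathwise Ito formula the sums of \<open>R\<close> over \<open>[0, t]\<close> converge to \<open>- \<Gamma>(t)\<close>
  and the sums of \<open>|R|\<close> stay bounded (weak convergence of signed measures); and the sums of \<open>G \<Delta>E\<close>
  converge to \<open>\<integral> E d\<Gamma>\<close> by the chain rule for \<open>E\<close>, which needs the continuity of \<open>\<Gamma>\<close>.\<close>

section \<open>Sums over the cells of a partition\<close>

text \<open>Regularity gives \<open>\<Gamma>\<close> bounded variation but not continuity, and
  \<open>\<Gamma>\<close> is only known as a pointwise limit of sums, which says nothing about its
  dependence on \<open>t\<close>. The proof therefore carries a weight \<open>control s u\<close>:
  the increment of the variation of \<open>A\<close> plus the squared increments of
  \<open>\<mu>\<close>. A multiple \<open>C * control\<close> dominates the Taylor remainder, and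
  the sums of \<open>control\<close> converge to a function that is continuous by the assumption on
  the covariations. Since \<open>C * control + remainder\<close> and
  \<open>C * control - remainder\<close> are nonnegative, their limits are nondecreasing in
  \<open>t\<close>, and this squeezes the increments of \<open>\<Gamma>\<close>. The integral of
  \<open>E\<close> against \<open>\<Gamma>\<close> enters twice with opposite signs. It is
  represented by one number \<open>L\<close>, the common limit of the sums of \<open>E\<close>
  weighted with the remainder and with the increments of \<open>- \<Gamma>\<close>, and it cancels.
  In the identity for the increments of \<open>G E\<close> the factor \<open>E\<close> of the
  gradient term sits at the left end of the cell, as the pathwise integral demands; this forces
  \<open>G\<close> in the last term to the right end.\<close>

definition cell_sum :: "real set \<Rightarrow> (real \<Rightarrow> real \<Rightarrow> real) \<Rightarrow> real" where
  "cell_sum D w = (\<Sum>(s, u) \<in> cells D. w s u)"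

lemma cells_subset: "cells D \<subseteq> D \<times> D"
  by (auto simp: cells_def)

lemma finite_cells [simp]: "finite D \<Longrightarrow> finite (cells D)"
  by (rule finite_subset[OF cells_subset]) simp

lemma cells_empty [simp]: "cells {} = {}" and cells_singleton [simp]: "cells {a} = {}"
  by (auto simp: cells_def)

lemma cells_pair: "a < b \<Longrightarrow> cells {a, b} = {(a, b)}"
  by (auto simp: cells_def)

text \<open>No cell has \<open>b\<close> in its interior, so each lies entirely on one side of
  \<open>b\<close>.\<close>

lemma cells_split:
  assumes "b \<in> D"
  shows "cells D = cells (D \<inter> {..b}) \<union> cells (D \<inter> {b..})"
    and "cells (D \<inter> {..b}) \<inter> cells (D \<inter> {b..}) = {}"
proof -
  have "u \<le> b \<or> b \<le> s" if "(s, u) \<in> cells D" for s u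
  proof -
    have "b \<notin> {s<..<u}" using that assms by (auto simp: cells_def)
    then show ?thesis by auto
  qed
  then have "cells D = {(s, u) \<in> cells D. u \<le> b} \<union> {(s, u) \<in> cells D. b \<le> s}"
    by blast
  moreover have "cells (D \<inter> {..b}) = {(s, u) \<in> cells D. u \<le> b}"
    "cells (D \<inter> {b..}) = {(s, u) \<in> cells D. b \<le> s}"
    by (auto simp: cells_def)
  ultimately show "cells D = cells (D \<inter> {..b}) \<union> cells (D \<inter> {b..})"
    by simp
  show "cells (D \<inter> {..b}) \<inter> cells (D \<inter> {b..}) = {}"
    by (auto simp: cells_def)
qed

lemma cell_sum_split:
  assumes "finite D" "b \<in> D"
  shows "cell_sum D w = cell_sum (D \<inter> {..b}) w + cell_sum (D \<inter> {b..}) w"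
  unfolding cell_sum_def cells_split(1)[OF assms(2)]
  by (rule sum.union_disjoint) (use assms cells_split(2) in auto)

text \<open>Inserting points from left to right creates one cell at a time and destroys none; this
  recursion drives the inductions by \<open>finite_linorder_max_induct\<close>.\<close>

lemma cells_insert_max:
  assumes "finite A" "A \<noteq> {}" "\<forall>a\<in>A. a < b"
  shows "cells (insert b A) = insert (Max A, b) (cells A)"
proof -
  have "Max A \<in> A" "\<And>a. a \<in> A \<Longrightarrow> a \<le> Max A" using assms by auto
  with assms(3) show ?thesis
    by (fastforce simp: cells_def)
qed

lemma cell_sum_insert_max:
  assumes "finite A" "A \<noteq> {}" "\<forall>a\<in>A. a < b"
  shows "cell_sum (insert b A) w = cell_sum A w + w (Max A) b"
proof -
  have "(Max A, b) \<notin> cells A" using assms(3) by (auto simp: cells_def)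
  then show ?thesis
    unfolding cell_sum_def cells_insert_max[OF assms] using assms(1) by simp
qed

lemma cell_sum_empty [simp]: "cell_sum {} w = 0"
  and cell_sum_singleton [simp]: "cell_sum {a} w = 0"
  by (auto simp: cell_sum_def)

lemma cell_sum_telescope:
  assumes "finite D" "D \<noteq> {}"
  shows "cell_sum D (\<lambda>s u. f u - f s) = f (Max D) - f (Min D)"
  using assms
proof (induction D rule: finite_linorder_max_induct)
  case (insert b A)
  show ?case
  proof (cases "A = {}")
    case False
    have b: "Max (insert b A) = b" by (rule Max_eqI) (use insert in auto)
    have a: "Min (insert b A) = Min A" using insert False by (auto simp: min_def dest: leD)
    show ?thesis unfolding a b
      using insert False by (simp add: cell_sum_insert_max)
  qed auto
qed auto

lemma cell_sum_mono:
  assumes "\<And>s u. (s, u) \<in> cells D \<Longrightarrow> w s u \<le> w' s u"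
  shows "cell_sum D w \<le> cell_sum D w'"
  unfolding cell_sum_def by (rule sum_mono) (use assms in auto)

lemma cell_sum_nonneg:
  assumes "\<And>s u. (s, u) \<in> cells D \<Longrightarrow> 0 \<le> w s u"
  shows "0 \<le> cell_sum D w"
  unfolding cell_sum_def by (rule sum_nonneg) (use assms in auto)

lemma cell_sum_abs: "\<bar>cell_sum D w\<bar> \<le> cell_sum D (\<lambda>s u. \<bar>w s u\<bar>)"
  unfolding cell_sum_def by (rule order_trans[OF sum_abs]) (simp add: case_prod_unfold)

lemma cell_sum_add: "cell_sum D (\<lambda>s u. w s u + w' s u) = cell_sum D w + cell_sum D w'"
  and cell_sum_diff: "cell_sum D (\<lambda>s u. w s u - w' s u) = cell_sum D w - cell_sum D w'"
  and cell_sum_mult: "cell_sum D (\<lambda>s u. c * w s u) = c * cell_sum D w"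
  and cell_sum_sum: "cell_sum D (\<lambda>s u. \<Sum>i\<in>I. v i s u) = (\<Sum>i\<in>I. cell_sum D (v i))"
proof -
  show "cell_sum D (\<lambda>s u. \<Sum>i\<in>I. v i s u) = (\<Sum>i\<in>I. cell_sum D (v i))"
    unfolding cell_sum_def case_prod_unfold by (rule sum.swap)
qed (simp_all add: cell_sum_def case_prod_unfold sum.distrib sum_subtractf sum_distrib_left)

text \<open>Every point of \<open>D\<close> splits the finer sum. As \<open>D'\<close> may reach
  beyond \<open>D\<close>, it is cut to the hull of \<open>D\<close>, which lets the induction
  advance by one coarse cell at a time.\<close>

lemma cell_sum_refine:
  assumes "finite D" "D \<noteq> {}" "finite D'" "D \<subseteq> D'"
  shows "cell_sum (D' \<inter> {Min D..Max D}) w =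
    (\<Sum>(p, q) \<in> cells D. cell_sum (D' \<inter> {p..q}) w)"
  using assms
proof (induction D rule: finite_linorder_max_induct)
  case (insert b A)
  show ?case
  proof (cases "A = {}")
    case True
    then have "D' \<inter> {Min (insert b A)..Max (insert b A)} = {b}" using insert by auto
    with True show ?thesis by simp
  next
    case False
    have b: "Max (insert b A) = b" by (rule Max_eqI) (use insert in auto)
    have a: "Min (insert b A) = Min A" using insert False by (auto simp: min_def dest: leD)
    have m: "Max A \<in> A" "Min A \<le> Max A" "Max A < b" using False insert by auto
    have 1: "D' \<inter> {Min A..b} \<inter> {..Max A} = D' \<inter> {Min A..Max A}"
      "D' \<inter> {Min A..b} \<inter> {Max A..} = D' \<inter> {Max A..b}"
      using m by auto
    have "cell_sum (D' \<inter> {Min A..b}) w =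
        cell_sum (D' \<inter> {Min A..Max A}) w + cell_sum (D' \<inter> {Max A..b}) w"
      by (subst cell_sum_split[where b = "Max A"]) (use insert m 1 in auto)
    moreover have "(Max A, b) \<notin> cells A" using insert by (auto simp: cells_def)
    ultimately show ?thesis
      using insert False unfolding a b cells_insert_max[OF insert(1) False insert(2)] by simp
  qed
qed auto

text \<open>Of two different left ends, the larger would be a point of \<open>D\<close> inside the
  other cell.\<close>

lemma cells_snd_inj: "(p, s) \<in> cells D \<Longrightarrow> (p', s) \<in> cells D \<Longrightarrow> p = p'"
proof (rule ccontr)
  assume "(p, s) \<in> cells D" "(p', s) \<in> cells D" "p \<noteq> p'"
  then have "p' \<notin> {p<..<s}" "p \<notin> {p'<..<s}" "p < s" "p' < s" "p \<noteq> p'"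
    by (auto simp: cells_def)
  then show False by auto
qed

lemma card_cells_le:
  assumes "finite D"
  shows "card (cells D) \<le> card D"
proof -
  have "inj_on snd (cells D)"
    using cells_snd_inj by (auto simp: inj_on_def)
  then show ?thesis
    by (rule card_inj_on_le) (use assms in \<open>auto simp: cells_def\<close>)
qed

section \<open>Refining partitions\<close>

text \<open>Replacing the right end of the last cell by \<open>t\<close> amounts to summing over a
  genuine partition of [0, t], namely this one.\<close>

definition trunc :: "(nat \<Rightarrow> real set) \<Rightarrow> real \<Rightarrow> nat \<Rightarrow> real set" where
  "trunc P t n = insert t (P n \<inter> {..t})"

text \<open>The condition \<open>w t t = 0\<close> matters when \<open>t\<close> is itself a
  partition point below \<open>T\<close>: the cell that starts at \<open>t\<close> is then counted
  on the left with both arguments equal to \<open>t\<close>.\<close>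

lemma sum_cells_trunc:
  assumes "refining_partitions T P" "t \<in> {0..T}" "w t t = 0"
  shows "(\<Sum>(s, u) \<in> {(s, u) \<in> cells (P n). s \<le> t}. w s (min u t)) = cell_sum (trunc P t n) w"
proof -
  define A where "A = P n \<inter> {..t}"
  have fin: "finite (P n)" and P: "0 \<in> P n" "T \<in> P n" "P n \<subseteq> {0..T}"
    using assms(1) by (auto simp: refining_partitions_def)
  have A: "finite A" "A \<noteq> {}" "0 \<in> A" using fin P assms(2) by (auto simp: A_def)
  define p where "p = Max A"
  have p: "p \<in> A" "p \<in> P n" "p \<le> t" "\<And>a. a \<in> A \<Longrightarrow> a \<le> p" using A by (auto simp: p_def A_def)
      (metis A(1,2) A_def Int_iff Max_in atMost_iff)+
  \<comment> \<open>The cells that end beyond \<open>t\<close>: there is at most one, and it starts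
    at \<open>p\<close>, the last partition point not beyond \<open>t\<close>.\<close>
  define R where "R = {(s, u) \<in> cells (P n). s \<le> t \<and> t < u}"
  have eq: "{(s, u) \<in> cells (P n). s \<le> t} = cells A \<union> R"
    by (auto simp: R_def cells_def A_def)
  have finR: "finite R" unfolding R_def by (rule finite_subset[of _ "cells (P n)"]) (use fin in auto)
  have R: "R \<subseteq> {p} \<times> UNIV"
  proof
    fix x assume "x \<in> R"
    then obtain s u where x: "x = (s, u)" "s \<in> A" "t < u" "P n \<inter> {s<..<u} = {}"
      by (auto simp: R_def cells_def A_def)
    then have "p \<notin> {s<..<u}" using p(2) by blast
    with p(3) p(4)[OF x(2)] x show "x \<in> {p} \<times> UNIV" by auto
  qed
  have "(\<Sum>(s, u) \<in> cells A \<union> R. w s (min u t)) =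
      (\<Sum>(s, u) \<in> cells A. w s (min u t)) + (\<Sum>(s, u) \<in> R. w s (min u t))"
  proof (rule sum.union_disjoint)
    show "finite (cells A)" using A by simp
    show "cells A \<inter> R = {}" by (auto simp: R_def A_def cells_def)
  qed (rule finR)
  also have "(\<Sum>(s, u) \<in> cells A. w s (min u t)) = cell_sum A w"
    unfolding cell_sum_def by (rule sum.cong) (auto simp: A_def cells_def min_def)
  also have "(\<Sum>(s, u) \<in> R. w s (min u t)) = (if p = t then 0 else w p t)"
  proof (cases "p = t")
    case True
    then have "\<forall>x\<in>R. (case x of (s, u) \<Rightarrow> w s (min u t)) = 0"
      using R assms(3) by (auto simp: R_def)
    then show ?thesis using True by (simp add: sum.neutral)
  next
    case False
    with p have pt: "p < t" by auto
    have "t \<noteq> T" using P pt p by (force simp: A_def)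
    then have tT: "t < T" using assms(2) by auto
    define u where "u = Min (P n \<inter> {t<..})"
    have "P n \<inter> {t<..} \<noteq> {}" using tT P by auto
    then have "u \<in> P n \<inter> {t<..}" unfolding u_def using fin by (intro Min_in) auto
    moreover have u3: "\<And>x. x \<in> P n \<Longrightarrow> t < x \<Longrightarrow> u \<le> x" unfolding u_def using fin by auto
    ultimately have u: "u \<in> P n" "t < u" by auto
    have gap: "x \<le> p \<or> u \<le> x" if "x \<in> P n" for x
      using that u3[of x] p(4)[of x] by (cases "x \<le> t") (auto simp: A_def)
    have "P n \<inter> {p<..<u} = {}" using gap by force
    then have "(p, u) \<in> R" using u p pt by (auto simp: R_def cells_def)
    moreover have "x = (p, u)" if x: "x \<in> R" for x
    proof -
      obtain v where v: "x = (p, v)" using R x by blast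
      have "v \<in> P n" "t < v" "u \<notin> {p<..<v}" using x u by (auto simp: v R_def cells_def)
      then have "v = u" using u3[of v] u pt by auto
      with v show ?thesis by simp
    qed
    ultimately have "R = {(p, u)}" by blast
    then show ?thesis using u False by (simp add: min_def)
  qed
  also have "cell_sum A w + (if p = t then 0 else w p t) = cell_sum (trunc P t n) w"
  proof (cases "p = t")
    case True
    then have "trunc P t n = A" using p by (auto simp: trunc_def A_def)
    with True show ?thesis by simp
  next
    case False
    then have "\<forall>a\<in>A. a < t" using p(3,4) by force
    then show ?thesis using False A cell_sum_insert_max[of A t w]
      by (simp add: trunc_def A_def[symmetric] p_def)
  qed
  finally show ?thesis using eq by simp
qed

lemma trunc_props:
  assumes "refining_partitions T P" "t \<in> {0..T}"
  shows "finite (trunc P t n)" "0 \<in> trunc P t n" "t \<in> trunc P t n" "trunc P t n \<subseteq> {0..t}"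
    "trunc P t n \<noteq> {}" "Min (trunc P t n) = 0" "Max (trunc P t n) = t"
proof -
  show *: "finite (trunc P t n)" "0 \<in> trunc P t n" "t \<in> trunc P t n" "trunc P t n \<subseteq> {0..t}"
    using assms by (fastforce simp: refining_partitions_def trunc_def)+
  then show "trunc P t n \<noteq> {}" by auto
  show "Min (trunc P t n) = 0" by (rule Min_eqI) (use * in auto)
  show "Max (trunc P t n) = t" by (rule Max_eqI) (use * in auto)
qed

lemma trunc_mono:
  assumes "refining_partitions T P" "m \<le> n"
  shows "trunc P t m \<subseteq> trunc P t n"
  using assms by (fastforce simp: refining_partitions_def trunc_def incseq_def)

text \<open>Truncation only shortens cells, so the mesh of \<open>P n\<close> bounds the cells of
  all truncations at once; this makes \<open>trunc_fine\<close> uniform in \<open>t\<close>.\<close>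

lemma cells_trunc_extend:
  assumes "refining_partitions T P" "t \<in> {0..T}" "(s, u) \<in> cells (trunc P t n)"
  obtains u' where "(s, u') \<in> cells (P n)" "u \<le> u'"
proof -
  have fin: "finite (P n)" and P: "T \<in> P n"
    using assms(1) by (auto simp: refining_partitions_def)
  have s: "s \<in> P n" "s < u" "u \<le> t" "trunc P t n \<inter> {s<..<u} = {}"
    using assms(3) by (auto simp: cells_def trunc_def)
  have ut: "u \<in> P n \<or> u = t" using assms(3) by (auto simp: cells_def trunc_def)
  define u' where "u' = Min (P n \<inter> {u..})"
  have "P n \<inter> {u..} \<noteq> {}" using P s assms(2) by auto
  then have "u' \<in> P n \<inter> {u..}" unfolding u'_def using fin by (intro Min_in) auto
  then have u: "u' \<in> P n" "u \<le> u'" by auto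
  have u3: "\<And>x. x \<in> P n \<Longrightarrow> u \<le> x \<Longrightarrow> u' \<le> x" unfolding u'_def using fin by auto
  have "x \<notin> P n" if "s < x" "x < u'" for x
  proof
    assume x: "x \<in> P n"
    with u3 that have "x < u" by force
    with x that s show False by (auto simp: trunc_def)
  qed
  then have "(s, u') \<in> cells (P n)" using s u by (force simp: cells_def)
  then show thesis using u that by blast
qed

lemma trunc_fine:
  assumes "refining_partitions T P" "0 < \<delta>"
  shows "\<forall>\<^sub>F n in sequentially. \<forall>t\<in>{0..T}. \<forall>(s, u) \<in> cells (trunc P t n). u - s < \<delta>"
proof -
  have "(\<lambda>n. mesh (P n)) \<longlonglongrightarrow> 0" using assms(1) by (simp add: refining_partitions_def)
  then have "\<forall>\<^sub>F n in sequentially. mesh (P n) < \<delta>"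
    using assms(2) by (rule order_tendstoD)
  then show ?thesis
  proof eventually_elim
    case (elim n)
    have fin: "finite (P n)" using assms(1) by (simp add: refining_partitions_def)
    show ?case
    proof (safe)
      fix t s u assume "t \<in> {0..T}" "(s, u) \<in> cells (trunc P t n)"
      then obtain u' where u': "(s, u') \<in> cells (P n)" "u \<le> u'"
        using cells_trunc_extend assms(1) by blast
      have "u' - s \<le> mesh (P n)"
        unfolding mesh_def by (rule Max_ge) (use u' fin in force)+
      with u' elim show "u - s < \<delta>" by simp
    qed
  qed
qed

text \<open>Nestedness of the partitions enters here: a point \<open>q\<close> of one truncation
  remains a point of all later ones, so from then on the sum up to \<open>q\<close> is an initial
  segment of the sum up to \<open>t\<close>.\<close>

lemma trunc_Int_atMost:
  assumes "refining_partitions T P" "t \<in> {0..T}" "q \<in> trunc P t m" "m \<le> n"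
  shows "trunc P t n \<inter> {..q} = trunc P q n"
  using assms trunc_mono[OF assms(1,4), of t] by (auto simp: trunc_def)

lemma cells_trunc_subset:
  "cells (trunc P s n) \<subseteq> cells (trunc P t n) \<union> {(p, s) | p. True}" if "s \<le> t"
  using that by (auto simp: cells_def trunc_def)

text \<open>Helly-type argument: approximate \<open>f\<close> by a step function on a coarse partition, on whose cells the
  distribution functions \<open>cell_sum (trunc P q n) w\<close> converge.\<close>

lemma weighted_cell_sum_limit:
  assumes P: "refining_partitions T P" and t: "t \<in> {0..T}"
    and f: "continuous_on {0..t} f"
    and bnd: "\<forall>\<^sub>F n in sequentially. cell_sum (trunc P t n) (\<lambda>s u. \<bar>w s u\<bar>) \<le> C"
    and lim: "\<And>q. q \<in> {0..t} \<Longrightarrow> (\<lambda>n. cell_sum (trunc P q n) w) \<longlonglongrightarrow> F q"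
  obtains L where "(\<lambda>n. cell_sum (trunc P t n) (\<lambda>s u. f s * w s u)) \<longlonglongrightarrow> L"
    and "(\<lambda>n. cell_sum (trunc P t n) (\<lambda>s u. f s * (F u - F s))) \<longlonglongrightarrow> L"
proof -
  define X where "X n = cell_sum (trunc P t n) (\<lambda>s u. f s * w s u)" for n
  define Z where "Z n = cell_sum (trunc P t n) (\<lambda>s u. f s * (F u - F s))" for n
  \<comment> \<open>Here \<open>f\<close> is frozen at the left ends of the coarse cells, while
    \<open>w\<close> is still summed over the fine partition. First \<open>n\<close> tends to
    infinity for fixed \<open>m\<close>, which gives \<open>Z m\<close>; then \<open>m\<close>
    grows.\<close>
  define Y where "Y m n = (\<Sum>(p, q) \<in> cells (trunc P t m). f p * cell_sum (trunc P t n \<inter> {p..q}) w)" for m n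
  note tr = trunc_props[OF P t]
  have YZ: "(\<lambda>n. Y m n) \<longlonglongrightarrow> Z m" for m
    unfolding Y_def Z_def cell_sum_def[of "trunc P t m"] case_prod_unfold
  proof (intro tendsto_sum tendsto_mult tendsto_const)
    fix c assume c: "c \<in> cells (trunc P t m)"
    obtain p q where pq: "c = (p, q)" by force
    have p: "p \<in> trunc P t m" "q \<in> trunc P t m" "p < q" using c pq by (auto simp: cells_def)
    have "p \<in> {0..t}" "q \<in> {0..t}" using p tr(4) by blast+
    then have "(\<lambda>n. cell_sum (trunc P q n) w - cell_sum (trunc P p n) w) \<longlonglongrightarrow> F q - F p"
      by (intro tendsto_diff lim)
    moreover have "\<forall>\<^sub>F n in sequentially. cell_sum (trunc P q n) w - cell_sum (trunc P p n) w
        = cell_sum (trunc P t n \<inter> {p..q}) w"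
      using eventually_ge_at_top[of m]
    proof eventually_elim
      case (elim n)
      have 1: "trunc P q n = trunc P t n \<inter> {..q}" "trunc P p n = trunc P t n \<inter> {..p}"
        using trunc_Int_atMost[OF P t _ elim] p by auto
      have p': "p \<in> trunc P t n" using p trunc_mono[OF P elim] by blast
      have "cell_sum (trunc P t n \<inter> {..q}) w =
        cell_sum (trunc P t n \<inter> {..q} \<inter> {..p}) w + cell_sum (trunc P t n \<inter> {..q} \<inter> {p..}) w"
        by (rule cell_sum_split) (use p' p tr(1) in auto)
      moreover have "trunc P t n \<inter> {..q} \<inter> {..p} = trunc P t n \<inter> {..p}"
        "trunc P t n \<inter> {..q} \<inter> {p..} = trunc P t n \<inter> {p..q}" using p by auto
      ultimately show ?case using 1 by simp
    qed
    ultimately show "(\<lambda>n. cell_sum (trunc P t n \<inter> {fst c..snd c}) w) \<longlonglongrightarrow> F (snd c) - F (fst c)"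
      using pq by (auto elim: Lim_transform_eventually)
  qed
  have key: "\<exists>M. \<forall>m\<ge>M. \<forall>n\<ge>m. \<bar>X n - Y m n\<bar> \<le> \<epsilon>" if e: "0 < \<epsilon>" for \<epsilon>
  proof -
    \<comment> \<open>The sign of \<open>C\<close> is unknown at this point, so
      \<open>\<bar>C\<bar> + 1\<close> serves as a positive bound for the sums of absolute
      values.\<close>
    define e' where "e' = \<epsilon> / (\<bar>C\<bar> + 1)"
    have e': "0 < e'" using e by (simp add: e'_def)
    have "uniformly_continuous_on {0..t} f"
      using f by (intro compact_uniformly_continuous) auto
    then obtain \<delta> where d: "0 < \<delta>" "\<And>x y. x \<in> {0..t} \<Longrightarrow> y \<in> {0..t} \<Longrightarrow> dist y x < \<delta> \<Longrightarrow> dist (f y) (f x) < e'"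
      using e' unfolding uniformly_continuous_on_def by metis
    have "\<forall>\<^sub>F n in sequentially. (\<forall>t\<in>{0..T}. \<forall>(s, u) \<in> cells (trunc P t n). u - s < \<delta>) \<and>
        cell_sum (trunc P t n) (\<lambda>s u. \<bar>w s u\<bar>) \<le> C"
      using trunc_fine[OF P d(1)] bnd by (rule eventually_conj)
    then obtain M where M: "\<And>n. n \<ge> M \<Longrightarrow> (\<forall>t\<in>{0..T}. \<forall>(s, u) \<in> cells (trunc P t n). u - s < \<delta>)"
      "\<And>n. n \<ge> M \<Longrightarrow> cell_sum (trunc P t n) (\<lambda>s u. \<bar>w s u\<bar>) \<le> C"
      unfolding eventually_sequentially by blast
    have "\<bar>X n - Y m n\<bar> \<le> \<epsilon>" if mn: "m \<ge> M" "n \<ge> m" for m n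
    proof -
      have sub: "trunc P t m \<subseteq> trunc P t n" using trunc_mono[OF P mn(2)] .
      have ref: "cell_sum (trunc P t n) v = (\<Sum>(p, q) \<in> cells (trunc P t m). cell_sum (trunc P t n \<inter> {p..q}) v)" for v
      proof -
        have "trunc P t n \<inter> {0..t} = trunc P t n" using tr(4)[of n] by blast
        then show ?thesis
          using cell_sum_refine[OF tr(1) tr(5) tr(1) sub, where w = v] tr(6,7) by simp
      qed
      have "\<bar>X n - Y m n\<bar> = \<bar>\<Sum>(p, q) \<in> cells (trunc P t m).
          cell_sum (trunc P t n \<inter> {p..q}) (\<lambda>s u. (f s - f p) * w s u)\<bar>"
        unfolding X_def Y_def ref[of "\<lambda>s u. f s * w s u"] sum_subtractf[symmetric]
        by (simp add: case_prod_unfold left_diff_distrib cell_sum_diff cell_sum_mult)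
      also have "\<dots> \<le> (\<Sum>(p, q) \<in> cells (trunc P t m).
          cell_sum (trunc P t n \<inter> {p..q}) (\<lambda>s u. e' * \<bar>w s u\<bar>))"
        unfolding case_prod_unfold
      proof (rule order_trans[OF sum_abs], rule sum_mono)
        fix c assume c: "c \<in> cells (trunc P t m)"
        obtain p q where pq: "c = (p, q)" by force
        have p: "p \<in> trunc P t m" "q \<in> trunc P t m" "p < q" "q - p < \<delta>"
          using c pq M(1)[OF mn(1)] t by (auto simp: cells_def)
        have "\<bar>(f s - f p) * w s u\<bar> \<le> e' * \<bar>w s u\<bar>" if "(s, u) \<in> cells (trunc P t n \<inter> {p..q})" for s u
        proof -
          have "s \<in> {0..t}" "s \<in> {p..q}" using that tr(4)[of n] by (auto simp: cells_def)
          moreover have "p \<in> {0..t}" using p tr(4)[of m] by auto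
          ultimately have "dist (f s) (f p) < e'" using p by (intro d) (auto simp: dist_real_def)
          then show ?thesis by (auto simp: abs_mult dist_real_def intro: mult_right_mono)
        qed
        then show "\<bar>cell_sum (trunc P t n \<inter> {fst c..snd c}) (\<lambda>s u. (f s - f (fst c)) * w s u)\<bar>
          \<le> cell_sum (trunc P t n \<inter> {fst c..snd c}) (\<lambda>s u. e' * \<bar>w s u\<bar>)"
          unfolding pq fst_conv snd_conv by (intro order_trans[OF cell_sum_abs] cell_sum_mono)
      qed
      also have "\<dots> = e' * cell_sum (trunc P t n) (\<lambda>s u. \<bar>w s u\<bar>)"
        by (simp add: ref[of "\<lambda>s u. \<bar>w s u\<bar>"] cell_sum_mult sum_distrib_left case_prod_unfold)
      also have "\<dots> \<le> e' * (\<bar>C\<bar> + 1)"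
        using M(2)[of n] mn e' by (intro mult_left_mono) auto
      also have "\<dots> = \<epsilon>" by (simp add: e'_def)
      finally show ?thesis .
    qed
    then show ?thesis by blast
  qed
  have near: "\<exists>M. \<forall>m\<ge>M. \<forall>\<^sub>F n in sequentially. \<bar>X n - Z m\<bar> \<le> \<epsilon>" if e: "0 < \<epsilon>" for \<epsilon>
  proof -
    obtain M where M: "\<And>m n. m \<ge> M \<Longrightarrow> n \<ge> m \<Longrightarrow> \<bar>X n - Y m n\<bar> \<le> \<epsilon> / 2"
      using key[of "\<epsilon> / 2"] e by auto
    have "\<forall>\<^sub>F n in sequentially. \<bar>X n - Z m\<bar> \<le> \<epsilon>" if m: "m \<ge> M" for m
    proof -
      have "\<forall>\<^sub>F n in sequentially. dist (Y m n) (Z m) < \<epsilon> / 2"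
        by (rule tendstoD[OF YZ]) (use e in simp)
      with eventually_ge_at_top[of m] show ?thesis
      proof eventually_elim
        case (elim n)
        with M[OF m, of n] show ?case unfolding dist_real_def by linarith
      qed
    qed
    then show ?thesis by blast
  qed
  \<comment> \<open>No candidate for the limit is at hand, but all late terms of \<open>X\<close>
    lie close to one single number \<open>Z M\<close>.\<close>
  have "Cauchy X"
  proof (rule metric_CauchyI)
    fix e :: real assume "0 < e"
    then obtain M where "\<forall>\<^sub>F n in sequentially. \<bar>X n - Z M\<bar> \<le> e / 3" using near[of "e/3"] by auto
    then obtain N where N: "\<And>n. n \<ge> N \<Longrightarrow> \<bar>X n - Z M\<bar> \<le> e / 3"
      unfolding eventually_sequentially by blast
    have "dist (X m) (X n) < e" if "m \<ge> N" "n \<ge> N" for m n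
      using N[OF that(1)] N[OF that(2)] \<open>0 < e\<close> unfolding dist_real_def by linarith
    then show "\<exists>N. \<forall>m\<ge>N. \<forall>n\<ge>N. dist (X m) (X n) < e" by blast
  qed
  then obtain L where L: "X \<longlonglongrightarrow> L" using Cauchy_convergent convergent_def by blast
  have "Z \<longlonglongrightarrow> L"
  proof (rule metric_LIMSEQ_I)
    fix e :: real assume "0 < e"
    then obtain M where M: "\<And>m. m \<ge> M \<Longrightarrow> \<forall>\<^sub>F n in sequentially. \<bar>X n - Z m\<bar> \<le> e / 2" using near[of "e/2"] by auto
    have "\<bar>L - Z m\<bar> \<le> e / 2" if "m \<ge> M" for m
      by (rule tendsto_upperbound[OF _ M[OF that]]) (intro tendsto_intros L, simp)
    with \<open>0 < e\<close> show "\<exists>N. \<forall>n\<ge>N. dist (Z n) L < e" 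
      by (intro exI[of _ M]) (fastforce simp: dist_real_def abs_minus_commute)
  qed
  with L show thesis using that unfolding X_def Z_def by blast
qed

text \<open>As \<open>w\<close> need not be additive, the cell cut off at \<open>s\<close> may
  outweigh the longer cell that replaces it in the truncation at \<open>t\<close>. It is the only
  cell of the earlier truncation that can get lost, and its weight is at most \<open>e\<close> once
  the mesh is small.\<close>

lemma cell_sum_limit_mono:
  assumes P: "refining_partitions T P" and su: "0 \<le> s" "s \<le> t" "t \<le> T"
    and nonneg: "\<And>p q. 0 \<le> p \<Longrightarrow> p < q \<Longrightarrow> q \<le> T \<Longrightarrow> 0 \<le> w p q"
    and small: "\<And>e. 0 < e \<Longrightarrow> \<exists>\<delta>>0. \<forall>p q. 0 \<le> p \<longrightarrow> p < q \<longrightarrow> q \<le> T \<longrightarrow> q - p < \<delta> \<longrightarrow> w p q \<le> e"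
    and lim: "\<And>q. q \<in> {0..T} \<Longrightarrow> (\<lambda>n. cell_sum (trunc P q n) w) \<longlonglongrightarrow> F q"
  shows "F s \<le> F t"
proof (rule field_le_epsilon)
  fix e :: real assume "0 < e"
  then obtain \<delta> where d: "\<delta> > 0" "\<And>p q. 0 \<le> p \<Longrightarrow> p < q \<Longrightarrow> q \<le> T \<Longrightarrow> q - p < \<delta> \<Longrightarrow> w p q \<le> e"
    using small by metis
  have s: "s \<in> {0..T}" and t: "t \<in> {0..T}" using su by auto
  have "\<forall>\<^sub>F n in sequentially. cell_sum (trunc P s n) w \<le> cell_sum (trunc P t n) w + e"
    using trunc_fine[OF P d(1)]
  proof eventually_elim
    case (elim n)
    note trs = trunc_props[OF P s, of n] and trt = trunc_props[OF P t, of n]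
    define A where "A = cells (trunc P s n) \<inter> cells (trunc P t n)"
    define B where "B = cells (trunc P s n) - cells (trunc P t n)"
    have "cell_sum (trunc P s n) w = (\<Sum>(s, u) \<in> A. w s u) + (\<Sum>(s, u) \<in> B. w s u)"
      unfolding cell_sum_def A_def B_def using trs(1) by (intro sum.Int_Diff) simp
    moreover have "(\<Sum>(s, u) \<in> A. w s u) \<le> cell_sum (trunc P t n) w"
      unfolding cell_sum_def
    proof (rule sum_mono2)
      fix c assume "c \<in> cells (trunc P t n) - A"
      then obtain p q where c: "c = (p, q)" "p < q" "p \<in> trunc P t n" "q \<in> trunc P t n"
        by (auto simp: cells_def)
      then have "p \<in> {0..t}" "q \<in> {0..t}" using trt(4) by blast+
      then show "0 \<le> (case c of (s, u) \<Rightarrow> w s u)" using c su by (auto intro!: nonneg)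
    qed (simp_all add: A_def trt)
    moreover have "(\<Sum>(s, u) \<in> B. w s u) \<le> e"
    proof (cases "B = {}")
      case False
      then obtain c where c: "c \<in> B" by blast
      \<comment> \<open>Every lost cell ends at \<open>s\<close>, and a cell is determined by its
        right end.\<close>
      have B: "B \<subseteq> {c}"
      proof
        fix x assume "x \<in> B"
        then obtain p p' where "x = (p, s)" "c = (p', s)" "(p, s) \<in> cells (trunc P s n)"
            "(p', s) \<in> cells (trunc P s n)"
          using c cells_trunc_subset[OF su(2), of P n] unfolding B_def by blast
        then show "x \<in> {c}" using cells_snd_inj by blast
      qed
      obtain p q where pq: "c = (p, q)" by force
      have pq': "(p, q) \<in> cells (trunc P s n)" using c pq by (simp add: B_def)
      then have "p < q" "p \<in> {0..s}" "q \<in> {0..s}" using trs(4) by (auto simp: cells_def)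
      moreover have "q - p < \<delta>" using elim s pq' by blast
      ultimately have "w p q \<le> e" using su by (intro d(2)) auto
      moreover have "B = {(p, q)}" using subset_singletonD[OF B] False pq by blast
      ultimately show ?thesis by simp
    qed (use \<open>0 < e\<close> in simp)
    ultimately show ?case by linarith
  qed
  then show "F s \<le> F t + e"
    by (intro tendsto_le[OF _ _ lim[OF s]]) (auto intro!: tendsto_intros lim[OF t])
qed

section \<open>Total variation\<close>

lemma norm_le_cell_sum:
  fixes F :: "real \<Rightarrow> 'a::real_normed_vector"
  assumes "finite D" "D \<noteq> {}"
  shows "norm (F (Max D) - F (Min D)) \<le> cell_sum D (\<lambda>s u. norm (F u - F s))"
  using assms
proof (induction D rule: finite_linorder_max_induct)
  case (insert b A)
  show ?case
  proof (cases "A = {}")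
    case False
    have b: "Max (insert b A) = b" by (rule Max_eqI) (use insert in auto)
    have a: "Min (insert b A) = Min A" using insert False by (auto simp: min_def dest: leD)
    have "norm (F b - F (Min A)) \<le> norm (F b - F (Max A)) + norm (F (Max A) - F (Min A))"
      using norm_triangle_ineq[of "F b - F (Max A)" "F (Max A) - F (Min A)"] by simp
    then show ?thesis unfolding a b
      using insert False by (simp add: cell_sum_insert_max)
  qed auto
qed auto

text \<open>Points inside a cell of \<open>D\<close> increase the sum by the triangle inequality;
  points outside the hull of \<open>D\<close> only add nonnegative terms.\<close>

lemma cell_sum_norm_refine:
  fixes F :: "real \<Rightarrow> 'a::real_normed_vector"
  assumes "finite D'" "D \<subseteq> D'"
  shows "cell_sum D (\<lambda>s u. norm (F u - F s)) \<le> cell_sum D' (\<lambda>s u. norm (F u - F s))"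
proof (cases "D = {}")
  case True
  then show ?thesis by (simp add: cell_sum_nonneg)
next
  case False
  let ?w = "\<lambda>s u. norm (F u - F s)"
  have fin: "finite D" using assms by (rule finite_subset[rotated])
  have "Min D \<in> D" "Max D \<in> D" using fin False by simp_all
  then have mM: "Min D \<in> D'" "Max D \<in> D'" "Min D \<le> Max D" using fin assms(2) by auto
  have "cell_sum D ?w \<le> (\<Sum>(p, q) \<in> cells D. cell_sum (D' \<inter> {p..q}) ?w)"
    unfolding cell_sum_def[of D]
  proof (rule sum_mono, clarify)
    fix p q assume "(p, q) \<in> cells D"
    then have pq: "p \<in> D'" "q \<in> D'" "p < q" using assms(2) by (auto simp: cells_def)
    have "Max (D' \<inter> {p..q}) = q" "Min (D' \<inter> {p..q}) = p"
      by (rule Max_eqI Min_eqI; use pq assms in auto)+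
    then show "?w p q \<le> cell_sum (D' \<inter> {p..q}) ?w"
      using norm_le_cell_sum[of "D' \<inter> {p..q}" F] pq assms(1)
      by (metis IntI atLeastAtMost_iff empty_iff finite_Int order.refl order_less_imp_le)
  qed
  also have "\<dots> = cell_sum (D' \<inter> {Min D..Max D}) ?w"
    using cell_sum_refine[OF fin False assms] by simp
  also have "D' \<inter> {Min D..Max D} = D' \<inter> {Min D..} \<inter> {..Max D}" by auto
  also have "cell_sum \<dots> ?w \<le> cell_sum (D' \<inter> {Min D..}) ?w"
    using cell_sum_split[of "D' \<inter> {Min D..}" "Max D" ?w] mM assms(1)
      cell_sum_nonneg[of "D' \<inter> {Min D..} \<inter> {Max D..}" ?w] by simp
  also have "\<dots> \<le> cell_sum D' ?w"
    using cell_sum_split[of D' "Min D" ?w] mM assms(1)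
      cell_sum_nonneg[of "D' \<inter> {..Min D}" ?w] by simp
  finally show ?thesis .
qed

lemma variation_sums_mono: "I \<subseteq> J \<Longrightarrow> variation_sums I F \<subseteq> variation_sums J F"
  unfolding variation_sums_def by blast

lemma variation_sums_nonempty: "variation_sums I F \<noteq> {}"
  unfolding variation_sums_def by blast

lemma bounded_variation_on_subset:
  "bounded_variation_on J F \<Longrightarrow> I \<subseteq> J \<Longrightarrow> bounded_variation_on I F"
  unfolding bounded_variation_on_def by (meson bdd_above_mono variation_sums_mono)

lemma cell_sum_le_total_variation:
  assumes "bounded_variation_on I F" "finite D" "D \<subseteq> I"
  shows "cell_sum D (\<lambda>s u. norm (F u - F s)) \<le> total_variation I F"
  unfolding total_variation_def cell_sum_def
  by (rule cSup_upper) (use assms in \<open>auto simp: variation_sums_def bounded_variation_on_def\<close>)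

lemma total_variation_le:
  assumes "\<And>D. finite D \<Longrightarrow> D \<subseteq> I \<Longrightarrow> cell_sum D (\<lambda>s u. norm (F u - F s)) \<le> B"
  shows "total_variation I F \<le> B"
  unfolding total_variation_def
  by (rule cSup_least[OF variation_sums_nonempty])
    (use assms in \<open>auto simp: variation_sums_def cell_sum_def\<close>)

text \<open>Finite sets on the two sides join at \<open>b\<close> to one finite set in the large
  interval.\<close>

lemma total_variation_superadditive:
  assumes "bounded_variation_on {a..c} F" "a \<le> b" "b \<le> c"
  shows "total_variation {a..b} F + total_variation {b..c} F \<le> total_variation {a..c} F"
proof -
  let ?w = "\<lambda>s u. norm (F u - F s)"
  have "cell_sum D1 ?w + cell_sum D2 ?w \<le> total_variation {a..c} F"
    if D: "finite D1" "D1 \<subseteq> {a..b}" "finite D2" "D2 \<subseteq> {b..c}" for D1 D2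
  proof -
    let ?D = "insert b (D1 \<union> D2)"
    have 1: "?D \<inter> {..b} \<supseteq> D1" "?D \<inter> {b..} \<supseteq> D2" using D by auto
    have "cell_sum D1 ?w + cell_sum D2 ?w \<le> cell_sum (?D \<inter> {..b}) ?w + cell_sum (?D \<inter> {b..}) ?w"
      by (intro add_mono cell_sum_norm_refine) (use 1 D in auto)
    also have "\<dots> = cell_sum ?D ?w"
      using D by (intro cell_sum_split[symmetric]) auto
    also have "\<dots> \<le> total_variation {a..c} F"
      by (rule cell_sum_le_total_variation) (use assms D in auto)
    finally show ?thesis .
  qed
  \<comment> \<open>The supremum is taken over \<open>D2\<close> first, with \<open>D1\<close>
    fixed, and then over \<open>D1\<close>.\<close>
  then have "cell_sum D1 ?w \<le> total_variation {a..c} F - total_variation {b..c} F"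
    if "finite D1" "D1 \<subseteq> {a..b}" for D1
    using total_variation_le[of "{b..c}" F "total_variation {a..c} F - cell_sum D1 ?w"] that
    by (force simp: algebra_simps)
  then have "total_variation {a..b} F \<le> total_variation {a..c} F - total_variation {b..c} F"
    by (rule total_variation_le)
  then show ?thesis by simp
qed

lemma norm_diff_le_total_variation:
  assumes "bounded_variation_on {0..T} F" "0 \<le> s" "s \<le> u" "u \<le> T"
  shows "norm (F u - F s) \<le> total_variation {0..u} F - total_variation {0..s} F"
proof -
  have "bounded_variation_on {0..u} F" "bounded_variation_on {s..u} F"
    by (rule bounded_variation_on_subset[OF assms(1)]; use assms in auto)+
  moreover from this have "norm (F u - F s) \<le> total_variation {s..u} F"
    using cell_sum_le_total_variation[of "{s..u}" F "{s, u}"] assms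
    by (cases "s = u") (auto simp: cell_sum_def cells_pair)
  ultimately show ?thesis
    using total_variation_superadditive[of 0 u F s] assms by simp
qed

lemma total_variation_mono:
  assumes "bounded_variation_on {0..T} F" "0 \<le> s" "s \<le> u" "u \<le> T"
  shows "total_variation {0..s} F \<le> total_variation {0..u} F"
  using norm_diff_le_total_variation[OF assms] norm_ge_zero[of "F u - F s"] by linarith

text \<open>A partition whose variation sum is nearly optimal on \<open>{0..T}\<close> is nearly optimal on every
  short interval, where it has a bounded number of cells of small increment.\<close>

lemma total_variation_continuous:
  fixes F :: "real \<Rightarrow> 'a::real_normed_vector"
  assumes bv: "bounded_variation_on {0..T} F" and cont: "continuous_on {0..T} F"
  shows "continuous_on {0..T} (\<lambda>t. total_variation {0..t} F)"
proof -
  let ?w = "\<lambda>s u. norm (F u - F s)"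
  let ?v = "\<lambda>t. total_variation {0..t} F"
  have key: "\<exists>\<delta>>0. \<forall>s u. 0 \<le> s \<longrightarrow> s \<le> u \<longrightarrow> u \<le> T \<longrightarrow> u - s < \<delta> \<longrightarrow> ?v u - ?v s < e"
    if e: "0 < e" for e
  proof -
    have "\<exists>x\<in>variation_sums {0..T} F. ?v T - e / 2 < x"
      unfolding total_variation_def using e by (intro less_cSupD variation_sums_nonempty) simp
    then obtain D where D: "finite D" "D \<subseteq> {0..T}" "?v T - e / 2 < cell_sum D ?w"
      by (auto simp: variation_sums_def cell_sum_def)
    \<comment> \<open>The two extra points are \<open>s\<close> and \<open>u\<close>, which are
      added to \<open>D\<close> below. Hence at most \<open>N\<close> cells lie between
      \<open>s\<close> and \<open>u\<close>, each of increment at most \<open>e / (2 * N)\<close>,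
      for a total of \<open>e / 2\<close>.\<close>
    define N where "N = real (card D + 2)"
    have N: "0 < N" by (simp add: N_def)
    have "uniformly_continuous_on {0..T} F"
      using cont by (intro compact_uniformly_continuous) auto
    moreover have "0 < e / (2 * N)" using e N by simp
    ultimately obtain \<delta> where d: "0 < \<delta>"
      "\<And>x y. x \<in> {0..T} \<Longrightarrow> y \<in> {0..T} \<Longrightarrow> dist y x < \<delta> \<Longrightarrow> dist (F y) (F x) < e / (2 * N)"
      unfolding uniformly_continuous_on_def by metis
    have "?v u - ?v s < e" if su: "0 \<le> s" "s \<le> u" "u \<le> T" "u - s < \<delta>" for s u
    proof -
      let ?D = "D \<union> {s, u}"
      have fin: "finite ?D" using D by simp
      have "cell_sum D ?w \<le> cell_sum ?D ?w"
        by (rule cell_sum_norm_refine) (use fin in auto)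
      also have "\<dots> = cell_sum (?D \<inter> {..s}) ?w + cell_sum (?D \<inter> {s..}) ?w"
        by (rule cell_sum_split) (use fin in auto)
      also have "cell_sum (?D \<inter> {s..}) ?w
          = cell_sum (?D \<inter> {s..} \<inter> {..u}) ?w + cell_sum (?D \<inter> {s..} \<inter> {u..}) ?w"
        by (rule cell_sum_split) (use fin su in auto)
      also have "cell_sum (?D \<inter> {..s}) ?w \<le> ?v s"
        by (rule cell_sum_le_total_variation[OF bounded_variation_on_subset[OF bv]])
          (use su fin D in auto)
      also have "cell_sum (?D \<inter> {s..} \<inter> {u..}) ?w \<le> total_variation {u..T} F"
        by (rule cell_sum_le_total_variation[OF bounded_variation_on_subset[OF bv]])
          (use su fin D in auto)
      also have "cell_sum (?D \<inter> {s..} \<inter> {..u}) ?w \<le> e / 2"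
      proof -
        have "cell_sum (?D \<inter> {s..} \<inter> {..u}) ?w \<le> real (card (cells (?D \<inter> {s..} \<inter> {..u}))) * (e / (2 * N))"
          unfolding cell_sum_def
        proof (rule sum_bounded_above)
          fix c assume "c \<in> cells (?D \<inter> {s..} \<inter> {..u})"
          then obtain p q where "c = (p, q)" "p < q" "s \<le> p" "q \<le> u" by (auto simp: cells_def)
          then show "(case c of (s, u) \<Rightarrow> norm (F u - F s)) \<le> e / (2 * N)"
            using d(2)[of p q] su by (simp add: dist_norm)
        qed
        also have "\<dots> \<le> N * (e / (2 * N))"
        proof (rule mult_right_mono)
          have "card (cells (?D \<inter> {s..} \<inter> {..u})) \<le> card (?D \<inter> {s..} \<inter> {..u})"
            by (rule card_cells_le) (use fin in auto)
          also have "\<dots> \<le> card ?D" by (rule card_mono) (use fin in auto)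
          also have "\<dots> \<le> card D + card {s, u}" by (rule card_Un_le)
          also have "card {s, u} \<le> 2" by (simp add: card_insert_if)
          finally show "real (card (cells (?D \<inter> {s..} \<inter> {..u}))) \<le> N" by (simp add: N_def)
        qed (use e N in simp)
        also have "\<dots> = e / 2" using N by simp
        finally show ?thesis .
      qed
      finally have "cell_sum D ?w \<le> ?v s + (e / 2 + total_variation {u..T} F)" by simp
      \<comment> \<open>The piece over \<open>{u..T}\<close> cancels; what is left is the
        \<open>e / 2\<close> of the short interval and the \<open>e / 2\<close> by which
        \<open>D\<close> misses the supremum.\<close>
      moreover have "?v u + total_variation {u..T} F \<le> ?v T"
        by (rule total_variation_superadditive) (use su bv in auto)
      ultimately show ?thesis using D(3) by linarith
    qed
    with d(1) show ?thesis by blast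
  qed
  show ?thesis
    unfolding continuous_on_iff
  proof (intro ballI allI impI)
    fix x e :: real assume x: "x \<in> {0..T}" and "0 < e"
    then obtain \<delta> where d: "\<delta> > 0" "\<And>s u. 0 \<le> s \<Longrightarrow> s \<le> u \<Longrightarrow> u \<le> T \<Longrightarrow> u - s < \<delta> \<Longrightarrow> ?v u - ?v s < e"
      using key by metis
    have "dist (?v y) (?v x) < e" if y: "y \<in> {0..T}" "dist y x < \<delta>" for y
    proof (cases "x \<le> y")
      case True
      then show ?thesis using d(2)[of x y] x y total_variation_mono[OF bv, of x y]
        by (simp add: dist_real_def)
    next
      case False
      then show ?thesis using d(2)[of y x] x y total_variation_mono[OF bv, of y x]
        by (simp add: dist_real_def)
    qed
    with d(1) show "\<exists>d>0. \<forall>x'\<in>{0..T}. dist x' x < d \<longrightarrow> dist (?v x') (?v x) < e" by blast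
  qed
qed

section \<open>Increments of the Stieltjes integral\<close>

lemma extend_const_mono:
  assumes "mono_on {0..t} F" "0 \<le> t"
  shows "x \<le> y \<Longrightarrow> extend_const t F x \<le> extend_const t F y"
  unfolding extend_const_def by (rule mono_onD[OF assms(1)]) (use assms(2) in auto)

lemma extend_const_continuous:
  assumes "continuous_on {0..t} F" "0 \<le> t"
  shows "continuous_on UNIV (extend_const t F)"
  unfolding extend_const_def
  by (rule continuous_on_compose2[OF assms(1)]) (use assms(2) in \<open>auto intro!: continuous_intros\<close>)

lemma extend_const_eq: "x \<in> {0..t} \<Longrightarrow> extend_const t F x = F x"
  by (simp add: extend_const_def)

context
  fixes T :: real and F :: "real \<Rightarrow> real"
  assumes mono: "mono_on {0..T} F" and cont: "continuous_on {0..T} F"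
begin

lemma emeasure_extend_const_Ioc:
  assumes "0 \<le> t" "t \<le> T"
  shows "emeasure (interval_measure (extend_const t F)) {a<..b} =
    (if a \<le> b then ennreal (extend_const t F b - extend_const t F a) else 0)"
proof -
  have F: "mono_on {0..t} F" "continuous_on {0..t} F"
    using mono cont assms by (auto intro: mono_on_subset continuous_on_subset)
  have "continuous (at_right x) (extend_const t F)" for x
    using extend_const_continuous[OF F(2) assms(1)]
    by (auto simp: continuous_on_eq_continuous_at intro: continuous_at_imp_continuous_at_within)
  then show ?thesis
    by (subst emeasure_interval_measure_Ioc_eq)
      (auto intro: extend_const_mono[OF F(1) assms(1)])
qed

text \<open>The measure in \<open>stieltjes_integral\<close> changes with the upper limit. Integrals
  up to \<open>s\<close> and up to \<open>u\<close> can be subtracted only because the two measures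
  agree on \<open>{0<..s}\<close>, which is checked on half-lines.\<close>

lemma interval_measure_restrict_indep:
  assumes "0 \<le> s" "s \<le> t" "t \<le> T"
  shows "density (interval_measure (extend_const t F)) (indicator {0<..s}) =
    density (interval_measure (extend_const s F)) (indicator {0<..s})"
proof (rule measure_eqI_lessThan)
  have Int: "{0<..s} \<inter> {x<..} = {max 0 x<..s}" for x by auto
  have eq: "emeasure (density (interval_measure (extend_const t' F)) (indicator {0<..s})) {x<..} =
      (if max 0 x \<le> s then ennreal (F s - F (max 0 x)) else 0)" if "s \<le> t'" "t' \<le> T" for t' x
    using assms that
    by (subst emeasure_restricted) (auto simp: Int emeasure_extend_const_Ioc extend_const_eq)
  fix x
  show "emeasure (density (interval_measure (extend_const t F)) (indicator {0<..s})) {x<..} < \<infinity>"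
    by (subst eq) (use assms in auto)
  show "emeasure (density (interval_measure (extend_const t F)) (indicator {0<..s})) {x<..} =
      emeasure (density (interval_measure (extend_const s F)) (indicator {0<..s})) {x<..}"
    by (subst (1 2) eq) (use assms in auto)
qed (simp_all)

lemma set_integrable_interval_measure:
  fixes g :: "real \<Rightarrow> real"
  assumes "0 \<le> t" "t \<le> T" "continuous_on UNIV g"
  shows "set_integrable (interval_measure (extend_const t F)) {a<..b} g"
proof -
  have "compact (g ` {a..b})"
    using assms(3) by (intro compact_continuous_image) (auto intro: continuous_on_subset)
  then obtain B where B: "\<And>x. x \<in> {a..b} \<Longrightarrow> norm (g x) \<le> B"
    using compact_imp_bounded bounded_iff by (metis (no_types, lifting) image_eqI)
  have [measurable]: "g \<in> borel_measurable borel"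
    using assms(3) by (rule borel_measurable_continuous_onI)
  show ?thesis
    unfolding set_integrable_def
    by (rule integrableI_bounded_set_indicator[where B = B])
      (use assms B in \<open>auto simp: emeasure_extend_const_Ioc\<close>)
qed

text \<open>On \<open>{s<..u}\<close> the integrand differs from \<open>c\<close> by at most
  \<open>e\<close>, and this interval has mass \<open>F u - F s\<close>.\<close>

lemma set_integral_interval_measure_increment:
  assumes g: "continuous_on {0..T} g" and su: "0 \<le> s" "s \<le> u" "u \<le> T"
    and osc: "\<And>x. x \<in> {s..u} \<Longrightarrow> \<bar>g x - c\<bar> \<le> e"
  shows "\<bar>(LINT x:{0<..u}|interval_measure (extend_const u F). g x) -
      (LINT x:{0<..s}|interval_measure (extend_const s F). g x) - c * (F u - F s)\<bar> \<le> e * (F u - F s)"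
proof -
  \<comment> \<open>The constant extension of \<open>g\<close> is continuous on the whole line,
    hence Borel, and agrees with \<open>g\<close> on every domain of integration used here.\<close>
  define h where "h = extend_const T g"
  have h: "continuous_on UNIV h" unfolding h_def using g su by (intro extend_const_continuous) auto
  have [measurable]: "h \<in> borel_measurable borel"
    using h by (rule borel_measurable_continuous_onI)
  have hg: "(LINT x:{0<..t}|interval_measure (extend_const t F). g x) =
    (LINT x:{0<..t}|interval_measure (extend_const t F). h x)" if "t \<le> T" for t
    by (rule set_lebesgue_integral_cong) (use that in \<open>auto simp: h_def extend_const_def\<close>)
  let ?M = "interval_measure (extend_const u F)"
  let ?N = "interval_measure (extend_const s F)"
  note int = set_integrable_interval_measure[of u h, OF _ su(3) h]
  \<comment> \<open>A set integral is turned into an integral against the restricted measure, to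
    which the independence of the upper limit applies.\<close>
  have dens: "(LINT x:{0<..s}|interval_measure (extend_const t F). h x) =
    integral\<^sup>L (density (interval_measure (extend_const t F)) (indicator {0<..s})) h" for t
  proof -
    have "integral\<^sup>L (density (interval_measure (extend_const t F)) (\<lambda>x. ennreal (indicator {0<..s} x))) h
      = (LINT x:{0<..s}|interval_measure (extend_const t F). h x)"
      unfolding set_lebesgue_integral_def by (rule integral_density) auto
    then show ?thesis by (simp add: ennreal_indicator)
  qed
  have eq: "(LINT x:{0<..s}|?M. h x) = (LINT x:{0<..s}|?N. h x)"
    unfolding dens using interval_measure_restrict_indep[OF su] by simp
  have "{0<..u} = {0<..s} \<union> {s<..u}" using su by auto
  then have "(LINT x:{0<..u}|?M. h x) = (LINT x:{0<..s}|?M. h x) + (LINT x:{s<..u}|?M. h x)"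
    using su int by (auto intro!: set_integral_Un)
  then have "(LINT x:{0<..u}|?M. g x) - (LINT x:{0<..s}|?N. g x) = (LINT x:{s<..u}|?M. h x)"
    using su by (simp add: hg eq)
  moreover have em: "emeasure ?M {s<..u} = ennreal (F u - F s)"
    using su by (simp add: emeasure_extend_const_Ioc extend_const_eq)
  have le: "F s \<le> F u" by (rule mono_onD[OF mono]) (use su in auto)
  have const: "(LINT x:{s<..u}|?M. k) = k * (F u - F s)" for k :: real
    using em le by (simp add: set_lebesgue_integral_def measure_def)
  moreover have intc: "set_integrable ?M {s<..u} (\<lambda>x. k)" for k :: real
    using su by (intro set_integrable_interval_measure) auto
  have "(LINT x:{s<..u}|?M. h x - c) = (LINT x:{s<..u}|?M. h x) - (LINT x:{s<..u}|?M. c)"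
    by (rule set_integral_diff) (use su int intc in auto)
  moreover have "\<bar>LINT x:{s<..u}|?M. h x - c\<bar> \<le> (LINT x:{s<..u}|?M. e)"
  proof -
    have 1: "set_integrable ?M {s<..u} (\<lambda>x. h x - c)" using su int intc by auto
    have "\<bar>LINT x:{s<..u}|?M. h x - c\<bar> \<le> (LINT x:{s<..u}|?M. \<bar>h x - c\<bar>)"
      using set_integral_norm_bound[OF 1] by simp
    also have "\<dots> \<le> (LINT x:{s<..u}|?M. e)"
    proof (rule set_integral_mono)
      show "set_integrable ?M {s<..u} (\<lambda>x. \<bar>h x - c\<bar>)" using 1 by (rule set_integrable_abs)
    qed (use intc osc su in \<open>auto simp: h_def extend_const_def\<close>)
    finally show ?thesis .
  qed
  ultimately show ?thesis by simp
qed

end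

text \<open>The positive and the negative variation each contribute an error of \<open>e\<close>
  times their own increment; these increments differ by that of \<open>F\<close> and add up to that
  of the total variation. The lemma is applied with \<open>c = 0\<close> for a crude bound and with
  \<open>c\<close> the value of \<open>g\<close> at \<open>s\<close> for the chain rule.\<close>

lemma stieltjes_integral_increment:
  assumes bv: "bounded_variation_on {0..T} F" and cont: "continuous_on {0..T} F"
    and g: "continuous_on {0..T} g" and su: "0 \<le> s" "s \<le> u" "u \<le> T"
    and osc: "\<And>x. x \<in> {s..u} \<Longrightarrow> \<bar>g x - c\<bar> \<le> e"
  shows "\<bar>stieltjes_integral g F u - stieltjes_integral g F s - c * (F u - F s)\<bar>
    \<le> e * (total_variation {0..u} F - total_variation {0..s} F)"
proof -
  let ?v = "\<lambda>t. total_variation {0..t} F"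
  let ?p = "positive_variation F" and ?n = "negative_variation F"
  have contv: "continuous_on {0..T} ?v" by (rule total_variation_continuous[OF bv cont])
  have abs: "\<bar>F y - F x\<bar> \<le> ?v y - ?v x" if "x \<in> {0..T}" "y \<in> {0..T}" "x \<le> y" for x y
    using norm_diff_le_total_variation[OF bv, of x y] that by simp
  have p: "mono_on {0..T} ?p" and n: "mono_on {0..T} ?n"
    by (auto intro!: mono_onI simp: positive_variation_def negative_variation_def; use abs in force)+
  have pc: "continuous_on {0..T} ?p" and nc: "continuous_on {0..T} ?n"
    unfolding positive_variation_def[abs_def] negative_variation_def[abs_def]
    by (intro continuous_intros contv cont; simp)+
  note P = set_integral_interval_measure_increment[OF p pc g su osc]
    and N = set_integral_interval_measure_increment[OF n nc g su osc]
  have pn: "?p u - ?p s = (?v u - ?v s + (F u - F s)) / 2" "?n u - ?n s = (?v u - ?v s - (F u - F s)) / 2"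
    by (simp_all add: positive_variation_def negative_variation_def field_simps)
  have cF: "c * (F u - F s) = c * (?p u - ?p s) - c * (?n u - ?n s)"
    "e * (?v u - ?v s) = e * (?p u - ?p s) + e * (?n u - ?n s)"
    unfolding pn by (simp_all add: field_simps)
  show ?thesis using P N unfolding cF stieltjes_integral_def by linarith
qed

section \<open>Taylor expansion for functions of class C(2,1)\<close>

lemma dir_deriv_at:
  assumes "has_cont_dir_deriv v G"
  shows "((\<lambda>h. G (z + h *\<^sub>R v)) has_real_derivative dir_deriv v G (z + \<tau> *\<^sub>R v)) (at \<tau>)"
proof -
  have "((\<lambda>h. G (z + \<tau> *\<^sub>R v + h *\<^sub>R v)) has_real_derivative dir_deriv v G (z + \<tau> *\<^sub>R v)) (at 0)"
    using assms unfolding has_cont_dir_deriv_def dir_deriv_def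
    by (simp add: DERIV_deriv_iff_field_differentiable)
  then have "((\<lambda>h. G (z + (\<tau> + h) *\<^sub>R v)) has_real_derivative dir_deriv v G (z + \<tau> *\<^sub>R v)) (at 0)"
    by (simp add: scaleR_add_left add.assoc)
  then show ?thesis
    using DERIV_shift[of "\<lambda>h. G (z + h *\<^sub>R v)" _ 0 \<tau>] by (simp add: add.commute)
qed

lemma dir_deriv_mvt:
  assumes "has_cont_dir_deriv v G"
  shows "\<exists>\<xi>. \<bar>\<xi>\<bar> \<le> \<bar>a\<bar> \<and> G (z + a *\<^sub>R v) - G z = a * dir_deriv v G (z + \<xi> *\<^sub>R v)"
proof -
  note D = dir_deriv_at[OF assms, of z]
  consider "a = 0" | "0 < a" | "a < 0" by linarith
  then show ?thesis
  proof cases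
    case 2
    with MVT2[OF 2 D] show ?thesis by force
  next
    case 3
    with MVT2[OF 3 D] obtain \<xi> where "a < \<xi>" "\<xi> < 0"
      "G z - G (z + a *\<^sub>R v) = (0 - a) * dir_deriv v G (z + \<xi> *\<^sub>R v)" by auto
    then show ?thesis by (intro exI[of _ \<xi>]) auto
  qed auto
qed

text \<open>\<open>C21\<close> speaks of coordinate directions only, so derivatives along sums of
  directions have to be built up. The path goes from \<open>z\<close> along \<open>w\<close> and
  then along \<open>v\<close>; on the second leg the mean value theorem gives an intermediate point
  \<open>y h\<close> that tends to \<open>z\<close>, where the derivative along \<open>v\<close> is
  continuous.\<close>

lemma dir_deriv_add:
  assumes v: "has_cont_dir_deriv v G"
    and w: "((\<lambda>h. G (z + h *\<^sub>R w)) has_real_derivative D) (at 0)"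
  shows "((\<lambda>h. G (z + h *\<^sub>R (c *\<^sub>R v + w))) has_real_derivative c * dir_deriv v G z + D) (at 0)"
proof -
  obtain \<xi> where xi: "\<And>y a. \<bar>\<xi> y a\<bar> \<le> \<bar>a\<bar>"
    "\<And>y a. G (y + a *\<^sub>R v) - G y = a * dir_deriv v G (y + \<xi> y a *\<^sub>R v)"
  proof -
    have "\<forall>y a. \<exists>\<xi>. \<bar>\<xi>\<bar> \<le> \<bar>a\<bar> \<and> G (y + a *\<^sub>R v) - G y = a * dir_deriv v G (y + \<xi> *\<^sub>R v)"
      using dir_deriv_mvt[OF v] by blast
    then show ?thesis using that by (auto simp: choice_iff)
  qed
  define y where "y h = z + h *\<^sub>R w + \<xi> (z + h *\<^sub>R w) (h * c) *\<^sub>R v" for h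
  have "((\<lambda>h. \<xi> (z + h *\<^sub>R w) (h * c)) \<longlongrightarrow> 0) (at 0)"
    by (rule Lim_null_comparison[where g = "\<lambda>h. \<bar>h * c\<bar>"])
      (use xi(1) in \<open>auto intro!: tendsto_eq_intros\<close>)
  then have "(y \<longlongrightarrow> z) (at 0)"
    unfolding y_def by (auto intro!: tendsto_eq_intros)
  moreover have "isCont (dir_deriv v G) z"
    using v by (simp add: has_cont_dir_deriv_def continuous_on_eq_continuous_at)
  ultimately have "((\<lambda>h. dir_deriv v G (y h)) \<longlongrightarrow> dir_deriv v G z) (at 0)"
    using isCont_tendsto_compose by blast
  then have "((\<lambda>h. c * dir_deriv v G (y h) + (G (z + h *\<^sub>R w) - G z) / h)
      \<longlongrightarrow> c * dir_deriv v G z + D) (at 0)"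
    using w by (intro tendsto_intros) (simp_all add: DERIV_def)
  moreover have "\<forall>\<^sub>F h in at 0. c * dir_deriv v G (y h) + (G (z + h *\<^sub>R w) - G z) / h =
      (G (z + h *\<^sub>R (c *\<^sub>R v + w)) - G z) / h"
    using eventually_neq_at_within[of "0::real" 0 UNIV]
  proof eventually_elim
    case (elim h)
    have "z + h *\<^sub>R (c *\<^sub>R v + w) = z + h *\<^sub>R w + (h * c) *\<^sub>R v" by (simp add: algebra_simps)
    then have "G (z + h *\<^sub>R (c *\<^sub>R v + w)) - G (z + h *\<^sub>R w) = h * c * dir_deriv v G (y h)"
      using xi(2)[of "z + h *\<^sub>R w" "h * c"] by (simp only: y_def)
    then have "G (z + h *\<^sub>R (c *\<^sub>R v + w)) - G z =
        h * (c * dir_deriv v G (y h)) + (G (z + h *\<^sub>R w) - G z)" by simp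
    then show ?case using elim by (simp add: field_simps)
  qed
  ultimately have "((\<lambda>h. (G (z + h *\<^sub>R (c *\<^sub>R v + w)) - G z) / h)
      \<longlongrightarrow> c * dir_deriv v G z + D) (at 0)"
    by (rule Lim_transform_eventually)
  then show ?thesis by (simp add: DERIV_def)
qed

lemma dir_deriv_sum:
  assumes "finite I" "\<And>i. i \<in> I \<Longrightarrow> has_cont_dir_deriv (v i) G"
  shows "((\<lambda>h. G (z + h *\<^sub>R (\<Sum>i\<in>I. c i *\<^sub>R v i))) has_real_derivative
    (\<Sum>i\<in>I. c i * dir_deriv (v i) G (z + \<tau> *\<^sub>R (\<Sum>i\<in>I. c i *\<^sub>R v i)))) (at \<tau>)"
proof -
  have 0: "((\<lambda>h. G (z + h *\<^sub>R (\<Sum>i\<in>J. c i *\<^sub>R v i))) has_real_derivative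
    (\<Sum>i\<in>J. c i * dir_deriv (v i) G z)) (at 0)" if "J \<subseteq> I" for J z
    using finite_subset[OF that assms(1)] that
  proof (induction J rule: finite_induct)
    case (insert b J)
    then show ?case using dir_deriv_add[of "v b" G z _ _ "c b"] assms(2) by simp
  qed simp
  let ?w = "\<Sum>i\<in>I. c i *\<^sub>R v i"
  have "((\<lambda>h. G (z + (\<tau> + h) *\<^sub>R ?w)) has_real_derivative
      (\<Sum>i\<in>I. c i * dir_deriv (v i) G (z + \<tau> *\<^sub>R ?w))) (at 0)"
    using 0[of I "z + \<tau> *\<^sub>R ?w"] by (simp add: scaleR_add_left add.assoc)
  then show ?thesis
    using DERIV_shift[of "\<lambda>h. G (z + h *\<^sub>R ?w)" _ 0 \<tau>] by (simp add: add.commute)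
qed

lemma vec_eq_sum_axis: "(\<Sum>i\<in>UNIV. x $ i *\<^sub>R axis i (1::real)) = x"
  by (simp add: vec_eq_iff axis_def if_distrib[of "\<lambda>x. _ * x"] cong: if_cong)

text \<open>The two groups of variables are moved separately: \<open>a\<close> moves at the new
  position \<open>x + b\<close> with a first order mean value theorem, and \<open>x\<close> moves at
  the old \<open>a\<close> with a second order Taylor formula. Hence exactly the derivatives that
  \<open>C21\<close> provides appear.\<close>

lemma C21_increment:
  fixes G :: "(real^'d) \<times> (real^'m) \<Rightarrow> real"
  assumes "C21 G"
  obtains \<tau> \<sigma> where "0 \<le> \<tau>" "\<tau> \<le> 1" "0 \<le> \<sigma>" "\<sigma> \<le> 1"
    "G (x + b, a + c) - G (x, a) - (\<Sum>i\<in>UNIV. partial_x i G (x, a) * b $ i) =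
      (\<Sum>k\<in>UNIV. dir_deriv (unit_a k) G (x + b, a + \<tau> *\<^sub>R c) * c $ k) +
      (\<Sum>i\<in>UNIV. \<Sum>j\<in>UNIV. dir_deriv (unit_x j) (partial_x i G) (x + \<sigma> *\<^sub>R b, a) * (b $ i * b $ j)) / 2"
proof -
  have C: "\<And>i. has_cont_dir_deriv (unit_x i) G"
    "\<And>i j. has_cont_dir_deriv (unit_x j) (partial_x i G)"
    "\<And>k. has_cont_dir_deriv (unit_a k) G"
    using assms by (auto simp: C21_def)
  have ux: "(\<Sum>i\<in>UNIV. b $ i *\<^sub>R (unit_x i :: (real^'d) \<times> (real^'m))) = (b, 0)"
    using vec_eq_sum_axis[of b] by (simp add: prod_eq_iff fst_sum snd_sum)
  have ua: "(\<Sum>k\<in>UNIV. c $ k *\<^sub>R (unit_a k :: (real^'d) \<times> (real^'m))) = (0, c)"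
    using vec_eq_sum_axis[of c] by (simp add: prod_eq_iff fst_sum snd_sum)
  have "((\<lambda>h. G (x + b, a + h *\<^sub>R c)) has_real_derivative
      (\<Sum>k\<in>UNIV. c $ k * dir_deriv (unit_a k) G (x + b, a + \<tau> *\<^sub>R c))) (at \<tau>)" for \<tau>
    using dir_deriv_sum[of UNIV unit_a G "(x + b, a)" "\<lambda>k. c $ k" \<tau>, unfolded ua] C(3) by simp
  then have "\<exists>\<tau>>0. \<tau> < 1 \<and> G (x + b, a + 1 *\<^sub>R c) - G (x + b, a + 0 *\<^sub>R c) =
      (1 - 0) * (\<Sum>k\<in>UNIV. c $ k * dir_deriv (unit_a k) G (x + b, a + \<tau> *\<^sub>R c))"
    by (intro MVT2) auto
  then obtain \<tau> where tau: "0 < \<tau>" "\<tau> < 1" "G (x + b, a + c) - G (x + b, a) =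
      (\<Sum>k\<in>UNIV. dir_deriv (unit_a k) G (x + b, a + \<tau> *\<^sub>R c) * c $ k)"
    by (auto simp: mult.commute)
  define \<phi> where "\<phi> h = G (x + h *\<^sub>R b, a)" for h
  define \<phi>1 where "\<phi>1 h = (\<Sum>i\<in>UNIV. b $ i * partial_x i G (x + h *\<^sub>R b, a))" for h
  define \<phi>2 where "\<phi>2 h = (\<Sum>i\<in>UNIV. b $ i * (\<Sum>j\<in>UNIV. b $ j *
    dir_deriv (unit_x j) (partial_x i G) (x + h *\<^sub>R b, a)))" for h
  have d1: "(\<phi> has_real_derivative \<phi>1 h) (at h)" for h
    using dir_deriv_sum[of UNIV unit_x G "(x, a)" "\<lambda>i. b $ i" h, unfolded ux] C(1)
    unfolding \<phi>_def[abs_def] \<phi>1_def by simp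
  have d2: "(\<phi>1 has_real_derivative \<phi>2 h) (at h)" for h
  proof -
    have "((\<lambda>h. partial_x i G (x + h *\<^sub>R b, a)) has_real_derivative
      (\<Sum>j\<in>UNIV. b $ j * dir_deriv (unit_x j) (partial_x i G) (x + h *\<^sub>R b, a))) (at h)" for i
      using dir_deriv_sum[of UNIV unit_x "partial_x i G" "(x, a)" "\<lambda>i. b $ i" h, unfolded ux] C(2)
      by simp
    then show ?thesis
      unfolding \<phi>1_def[abs_def] \<phi>2_def by (intro DERIV_sum DERIV_cmult)
  qed
  \<comment> \<open>The successive derivatives in the form that \<open>Maclaurin\<close> expects;
    only the orders 0, 1 and 2 occur.\<close>
  define diff where "diff m = (if m = 0 then \<phi> else if m = 1 then \<phi>1 else \<phi>2)" for m :: nat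
  have "\<exists>t. 0 < t \<and> t < 1 \<and> \<phi> 1 = (\<Sum>m<2. diff m 0 / fact m * 1 ^ m) + diff 2 t / fact 2 * 1 ^ 2"
    by (rule Maclaurin) (use d1 d2 in \<open>auto simp: diff_def\<close>)
  then obtain \<sigma> where sig: "0 < \<sigma>" "\<sigma> < 1" "\<phi> 1 = \<phi> 0 + \<phi>1 0 + \<phi>2 \<sigma> / 2"
    by (auto simp: diff_def numeral_2_eq_2)
  have "\<phi> 1 = G (x + b, a)" "\<phi> 0 = G (x, a)" "\<phi>1 0 = (\<Sum>i\<in>UNIV. partial_x i G (x, a) * b $ i)"
    "\<phi>2 \<sigma> = (\<Sum>i\<in>UNIV. \<Sum>j\<in>UNIV. dir_deriv (unit_x j) (partial_x i G) (x + \<sigma> *\<^sub>R b, a) * (b $ i * b $ j))"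
    by (simp_all add: \<phi>_def \<phi>1_def \<phi>2_def sum_distrib_left mult_ac)
  then show thesis using tau sig by (intro that[of \<tau> \<sigma>]) auto
qed

section \<open>The pathwise Ito formula\<close>

text \<open>Mixed products are bounded by half the sum of two squares, so only squared increments
  remain on the right; the dimensions count the summands.\<close>

lemma quadratic_form_bound:
  fixes b :: "real^'d" and c :: "real^'m"
  assumes "\<And>k. \<bar>\<alpha> k\<bar> \<le> e" "\<And>i j. \<bar>h i j\<bar> \<le> e" "norm c \<le> V"
  shows "\<bar>(\<Sum>k\<in>UNIV. \<alpha> k * c $ k) + (\<Sum>i\<in>UNIV. \<Sum>j\<in>UNIV. h i j * (b $ i * b $ j)) / 2\<bar>
    \<le> e * real (CARD('m) + CARD('d)) * (V + (\<Sum>i\<in>UNIV. (b $ i)\<^sup>2))"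
proof -
  let ?Q = "\<Sum>i\<in>UNIV. (b $ i)\<^sup>2"
  have e: "0 \<le> e" using assms(1) abs_ge_zero order_trans by blast
  have Q: "0 \<le> ?Q" by (intro sum_nonneg) simp
  have V: "0 \<le> V" using assms(3) norm_ge_zero order_trans by blast
  have "\<bar>\<alpha> k * c $ k\<bar> \<le> e * V" for k
    unfolding abs_mult
    by (intro mult_mono) (use assms e component_le_norm_cart[of c k] in auto)
  then have 1: "\<bar>\<Sum>k\<in>UNIV. \<alpha> k * c $ k\<bar> \<le> real CARD('m) * (e * V)"
    by (intro order_trans[OF sum_abs] sum_bounded_above)
  have "\<bar>h i j * (b $ i * b $ j)\<bar> \<le> e * (((b $ i)\<^sup>2 + (b $ j)\<^sup>2) / 2)" for i j
  proof -
    have "\<bar>b $ i * b $ j\<bar> \<le> ((b $ i)\<^sup>2 + (b $ j)\<^sup>2) / 2"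
      using sum_squares_bound[of "\<bar>b $ i\<bar>" "\<bar>b $ j\<bar>"] by (simp add: abs_mult)
    then show ?thesis
      unfolding abs_mult[of "h i j"] by (intro mult_mono) (use assms e in auto)
  qed
  then have "\<bar>\<Sum>i\<in>UNIV. \<Sum>j\<in>UNIV. h i j * (b $ i * b $ j)\<bar>
      \<le> (\<Sum>i\<in>UNIV. \<Sum>j\<in>UNIV. e * (((b $ i)\<^sup>2 + (b $ j)\<^sup>2) / 2))"
    by (intro order_trans[OF sum_abs] sum_mono) 
  also have "\<dots> = e * (\<Sum>i\<in>UNIV. \<Sum>j\<in>UNIV. ((b $ i)\<^sup>2 + (b $ j)\<^sup>2)) / 2"
    by (simp add: sum_distrib_left sum_divide_distrib)
  also have "(\<Sum>i\<in>UNIV. \<Sum>j\<in>UNIV. ((b $ i)\<^sup>2 + (b $ j)\<^sup>2)) = 2 * real CARD('d) * ?Q"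
    by (simp add: sum.distrib sum_distrib_left[symmetric])
  finally have 2: "\<bar>\<Sum>i\<in>UNIV. \<Sum>j\<in>UNIV. h i j * (b $ i * b $ j)\<bar> \<le> e * real CARD('d) * ?Q"
    by simp
  have "\<bar>(\<Sum>k\<in>UNIV. \<alpha> k * c $ k) + (\<Sum>i\<in>UNIV. \<Sum>j\<in>UNIV. h i j * (b $ i * b $ j)) / 2\<bar>
    \<le> real CARD('m) * (e * V) + e * real CARD('d) * ?Q"
    using 1 2 by linarith
  also have "\<dots> \<le> e * real (CARD('m) + CARD('d)) * (V + ?Q)"
    using e Q V by (simp add: algebra_simps)
  finally show ?thesis .
qed

locale ito_setting =
  fixes T :: real
    and P :: "nat \<Rightarrow> real set"
    and \<mu> :: "real \<Rightarrow> real^'d"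
    and A :: "real \<Rightarrow> real^'m"
    and G :: "(real^'d) \<times> (real^'m) \<Rightarrow> real"
  assumes partitions: "refining_partitions T P"
    and mu_cont: "continuous_on {0..T} \<mu>"
    and covariations: "has_covariations T P \<mu>"
    and A_CBV: "A \<in> CBV T"
    and C21: "C21 G"
begin

definition z :: "real \<Rightarrow> (real^'d) \<times> (real^'m)" where
  "z s = (\<mu> s, A s)"

definition remainder :: "real \<Rightarrow> real \<Rightarrow> real" where
  "remainder s u = G (z u) - G (z s) - (\<Sum>i\<in>UNIV. partial_x i G (z s) * (\<mu> u $ i - \<mu> s $ i))"

text \<open>The common majorant of the Taylor terms. Unlike them it is nonnegative, and the limit of
  its sums, \<open>control_limit\<close>, is continuous.\<close>

definition control :: "real \<Rightarrow> real \<Rightarrow> real" where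
  "control s u = (total_variation {0..u} A - total_variation {0..s} A) +
    (\<Sum>i\<in>UNIV. (\<mu> u $ i - \<mu> s $ i)\<^sup>2)"

definition control_limit :: "real \<Rightarrow> real" where
  "control_limit t = (total_variation {0..t} A - total_variation {0..0} A) +
    (\<Sum>i\<in>UNIV. covariation P (\<lambda>s. \<mu> s $ i) (\<lambda>s. \<mu> s $ i) t)"

text \<open>All derivatives that occur in the Taylor remainder are bundled into one continuous map,
  so that a single compactness argument bounds them and controls their moduli of continuity.\<close>

definition coeffs :: "(real^'d) \<times> (real^'m) \<Rightarrow> (real^'m) \<times> (real^'d^'d)" where
  "coeffs y = ((\<chi> k. dir_deriv (unit_a k) G y), (\<chi> i j. dir_deriv (unit_x j) (partial_x i G) y))"

text \<open>Two base points, because the derivatives in \<open>a\<close> and the second derivatives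
  in \<open>x\<close> are taken at different intermediate points. With \<open>p\<close> and
  \<open>q\<close> both equal to \<open>z s\<close> it is the left-point expression whose sums
  converge.\<close>

definition taylor_term ::
    "(real^'d) \<times> (real^'m) \<Rightarrow> (real^'d) \<times> (real^'m) \<Rightarrow> real \<Rightarrow> real \<Rightarrow> real" where
  "taylor_term p q s u = (\<Sum>k\<in>UNIV. dir_deriv (unit_a k) G p * (A u $ k - A s $ k)) +
    (\<Sum>i\<in>UNIV. \<Sum>j\<in>UNIV. dir_deriv (unit_x j) (partial_x i G) q *
      ((\<mu> u $ i - \<mu> s $ i) * (\<mu> u $ j - \<mu> s $ j))) / 2"

lemma A_props: "continuous_on {0..T} A" "bounded_variation_on {0..T} A"
  using A_CBV by (auto simp: CBV_def)

lemma z_cont: "continuous_on {0..T} z"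
  unfolding z_def[abs_def] by (intro continuous_intros mu_cont A_props)

lemma G_cont: "continuous_on X G"
  using C21 by (auto simp: C21_def intro: continuous_on_subset)

lemma dir_deriv_cont:
  "continuous_on X (partial_x i G)"
  "continuous_on X (dir_deriv (unit_a k) G)"
  "continuous_on X (dir_deriv (unit_x j) (partial_x i G))"
  using C21 by (simp_all add: C21_def has_cont_dir_deriv_def) (blast intro: continuous_on_subset)+

lemma coeffs_cont: "continuous_on X coeffs"
  unfolding coeffs_def[abs_def]
  by (intro continuous_intros dir_deriv_cont)

lemma total_variation_A_cont: "continuous_on {0..T} (\<lambda>t. total_variation {0..t} A)"
  by (rule total_variation_continuous[OF A_props(2,1)])

lemma uniform_modulus:
  fixes f :: "real \<Rightarrow> 'b::metric_space"
  assumes "continuous_on {0..T} f" "0 < e"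
  shows "\<exists>\<delta>>0. \<forall>s u. 0 \<le> s \<longrightarrow> s \<le> u \<longrightarrow> u \<le> T \<longrightarrow> u - s < \<delta> \<longrightarrow> dist (f u) (f s) < e"
proof -
  have "uniformly_continuous_on {0..T} f"
    using assms(1) by (intro compact_uniformly_continuous) auto
  then obtain \<delta> where "0 < \<delta>"
    "\<And>x y. x \<in> {0..T} \<Longrightarrow> y \<in> {0..T} \<Longrightarrow> dist y x < \<delta> \<Longrightarrow> dist (f y) (f x) < e"
    using assms(2) unfolding uniformly_continuous_on_def by metis
  then show ?thesis by (intro exI[of _ \<delta>]) (auto simp: dist_real_def)
qed

section \<open>Estimates for the Taylor remainder on one cell\<close>

lemma taylor_term_bound:
  assumes "norm (coeffs p) \<le> e" "norm (coeffs q) \<le> e" "0 \<le> s" "s \<le> u" "u \<le> T"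
  shows "\<bar>taylor_term p q s u\<bar> \<le> e * real (CARD('m) + CARD('d)) * control s u"
proof -
  have "\<bar>dir_deriv (unit_a k) G p\<bar> \<le> e" for k
    using component_le_norm_cart[of "fst (coeffs p)" k] norm_fst_le[of "fst (coeffs p)" "snd (coeffs p)"]
      assms(1) by (simp add: coeffs_def)
  moreover have "\<bar>dir_deriv (unit_x j) (partial_x i G) q\<bar> \<le> e" for i j
    using component_le_norm_cart[of "snd (coeffs q) $ i" j]
      Finite_Cartesian_Product.norm_nth_le[of "snd (coeffs q)" i]
      norm_snd_le[of "snd (coeffs q)" "fst (coeffs q)"]
      assms(2) by (simp add: coeffs_def)
  ultimately show ?thesis
    using norm_diff_le_total_variation[OF A_props(2) assms(3-5)]
      quadratic_form_bound[of "\<lambda>k. dir_deriv (unit_a k) G p" e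
        "\<lambda>i j. dir_deriv (unit_x j) (partial_x i G) q" "A u - A s" _ "\<mu> u - \<mu> s"]
    by (simp add: taylor_term_def control_def)
qed

lemma taylor_term_diff_bound:
  assumes "norm (coeffs p - coeffs p') \<le> e" "norm (coeffs q - coeffs q') \<le> e" "0 \<le> s" "s \<le> u" "u \<le> T"
  shows "\<bar>taylor_term p q s u - taylor_term p' q' s u\<bar> \<le> e * real (CARD('m) + CARD('d)) * control s u"
proof -
  let ?a = "\<lambda>k. dir_deriv (unit_a k) G p - dir_deriv (unit_a k) G p'"
  let ?h = "\<lambda>i j. dir_deriv (unit_x j) (partial_x i G) q - dir_deriv (unit_x j) (partial_x i G) q'"
  have "\<bar>?a k\<bar> \<le> e" for k
    using component_le_norm_cart[of "fst (coeffs p - coeffs p')" k]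
      norm_fst_le[of "fst (coeffs p - coeffs p')" "snd (coeffs p - coeffs p')"]
      assms(1) by (simp add: coeffs_def)
  moreover have "\<bar>?h i j\<bar> \<le> e" for i j
    using component_le_norm_cart[of "snd (coeffs q - coeffs q') $ i" j]
      Finite_Cartesian_Product.norm_nth_le[of "snd (coeffs q - coeffs q')" i]
      norm_snd_le[of "snd (coeffs q - coeffs q')" "fst (coeffs q - coeffs q')"]
      assms(2) by (simp add: coeffs_def)
  ultimately have "\<bar>(\<Sum>k\<in>UNIV. ?a k * (A u - A s) $ k) +
      (\<Sum>i\<in>UNIV. \<Sum>j\<in>UNIV. ?h i j * ((\<mu> u - \<mu> s) $ i * (\<mu> u - \<mu> s) $ j)) / 2\<bar>
      \<le> e * real (CARD('m) + CARD('d)) * ((total_variation {0..u} A - total_variation {0..s} A)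
        + (\<Sum>i\<in>UNIV. ((\<mu> u - \<mu> s) $ i)\<^sup>2))"
    by (intro quadratic_form_bound norm_diff_le_total_variation[OF A_props(2) assms(3-5)])
  moreover have "taylor_term p q s u - taylor_term p' q' s u = (\<Sum>k\<in>UNIV. ?a k * (A u - A s) $ k) +
      (\<Sum>i\<in>UNIV. \<Sum>j\<in>UNIV. ?h i j * ((\<mu> u - \<mu> s) $ i * (\<mu> u - \<mu> s) $ j)) / 2"
    by (simp add: taylor_term_def left_diff_distrib sum_subtractf diff_divide_distrib)
  ultimately show ?thesis by (simp add: control_def)
qed

text \<open>One compact set serves all pairs \<open>s\<close>, \<open>u\<close>. The factor 2 arises
  because \<open>p\<close> may differ from \<open>z s\<close> in both components, each by at most
  the distance of \<open>z u\<close> and \<open>z s\<close>.\<close>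

lemma remainder_eq_taylor_term:
  "\<exists>X. compact X \<and> z ` {0..T} \<subseteq> X \<and>
    (\<forall>s u. 0 \<le> s \<longrightarrow> s \<le> u \<longrightarrow> u \<le> T \<longrightarrow> (\<exists>p\<in>X. \<exists>q\<in>X. remainder s u = taylor_term p q s u \<and>
      dist p (z s) \<le> 2 * dist (z u) (z s) \<and> dist q (z s) \<le> 2 * dist (z u) (z s)))"
proof -
  have "bounded (\<mu> ` {0..T})" "bounded (A ` {0..T})"
    using mu_cont A_props(1) by (auto intro!: compact_imp_bounded compact_continuous_image)
  then obtain R1 R2 where R: "\<And>s. s \<in> {0..T} \<Longrightarrow> norm (\<mu> s) \<le> R1" "\<And>s. s \<in> {0..T} \<Longrightarrow> norm (A s) \<le> R2"
    unfolding bounded_iff by (meson imageI)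
  \<comment> \<open>A product of balls is compact and convex in each factor, so it contains the
    intermediate points along with the path.\<close>
  define X where "X = (cball 0 R1 :: (real^'d) set) \<times> (cball 0 R2 :: (real^'m) set)"
  have "\<exists>p\<in>X. \<exists>q\<in>X. remainder s u = taylor_term p q s u \<and>
      dist p (z s) \<le> 2 * dist (z u) (z s) \<and> dist q (z s) \<le> 2 * dist (z u) (z s)"
    if su: "0 \<le> s" "s \<le> u" "u \<le> T" for s u
  proof -
    have m: "\<mu> s \<in> cball 0 R1" "\<mu> u \<in> cball 0 R1" "A s \<in> cball 0 R2" "A u \<in> cball 0 R2"
      using R[of s] R[of u] su by auto
    obtain \<tau> \<sigma> where ts: "0 \<le> \<tau>" "\<tau> \<le> 1" "0 \<le> \<sigma>" "\<sigma> \<le> 1" and eq: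
      "G (\<mu> s + (\<mu> u - \<mu> s), A s + (A u - A s)) - G (\<mu> s, A s) -
        (\<Sum>i\<in>UNIV. partial_x i G (\<mu> s, A s) * (\<mu> u - \<mu> s) $ i) =
      (\<Sum>k\<in>UNIV. dir_deriv (unit_a k) G (\<mu> s + (\<mu> u - \<mu> s), A s + \<tau> *\<^sub>R (A u - A s)) * (A u - A s) $ k) +
      (\<Sum>i\<in>UNIV. \<Sum>j\<in>UNIV. dir_deriv (unit_x j) (partial_x i G) (\<mu> s + \<sigma> *\<^sub>R (\<mu> u - \<mu> s), A s) *
        ((\<mu> u - \<mu> s) $ i * (\<mu> u - \<mu> s) $ j)) / 2"
      using C21_increment[OF C21] .
    define p where "p = (\<mu> u, A s + \<tau> *\<^sub>R (A u - A s))"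
    define q where "q = (\<mu> s + \<sigma> *\<^sub>R (\<mu> u - \<mu> s), A s)"
    have seg: "x + r *\<^sub>R (y - x) \<in> C" if "convex C" "x \<in> C" "y \<in> C" "0 \<le> r" "r \<le> 1"
      for x y :: "'v::real_vector" and r C
    proof -
      have "x + r *\<^sub>R (y - x) = (1 - r) *\<^sub>R x + r *\<^sub>R y" by (simp add: algebra_simps)
      then show ?thesis using convexD_alt[OF that] by simp
    qed
    have "p \<in> X" "q \<in> X"
      unfolding p_def q_def X_def by (intro SigmaI seg convex_cball m ts)+
    moreover have "remainder s u = taylor_term p q s u"
      using eq by (simp add: remainder_def taylor_term_def p_def q_def z_def)
    moreover have le: "norm (\<mu> u - \<mu> s) \<le> dist (z u) (z s)" "norm (A u - A s) \<le> dist (z u) (z s)"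
      using norm_fst_le[of "\<mu> u - \<mu> s" "A u - A s"] norm_snd_le[of "A u - A s" "\<mu> u - \<mu> s"]
      by (simp_all add: dist_norm z_def)
    have "dist p (z s) \<le> 2 * dist (z u) (z s)"
    proof -
      have "dist p (z s) \<le> norm (\<mu> u - \<mu> s) + norm (\<tau> *\<^sub>R (A u - A s))"
        using norm_Pair_le[of "\<mu> u - \<mu> s" "\<tau> *\<^sub>R (A u - A s)"] by (simp add: dist_norm z_def p_def)
      also have "norm (\<tau> *\<^sub>R (A u - A s)) \<le> 1 * norm (A u - A s)"
        unfolding norm_scaleR using ts by (intro mult_right_mono) auto
      finally show ?thesis using le by simp
    qed
    moreover have "dist q (z s) \<le> 2 * dist (z u) (z s)"
    proof -
      have "dist q (z s) \<le> norm (\<sigma> *\<^sub>R (\<mu> u - \<mu> s))"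
        using norm_Pair_le[of "\<sigma> *\<^sub>R (\<mu> u - \<mu> s)" "0::real^'m"] by (simp add: dist_norm z_def q_def)
      also have "norm (\<sigma> *\<^sub>R (\<mu> u - \<mu> s)) \<le> 1 * norm (\<mu> u - \<mu> s)"
        unfolding norm_scaleR using ts by (intro mult_right_mono) auto
      finally show ?thesis using le by (smt (verit) zero_le_dist)
    qed
    ultimately show ?thesis by blast
  qed
  moreover have "compact X" unfolding X_def by (intro compact_Times compact_cball)
  moreover have "z ` {0..T} \<subseteq> X" using R by (auto simp: X_def z_def)
  ultimately show ?thesis by blast
qed

lemma remainder_bound:
  obtains C where "0 \<le> C" "\<And>s u. 0 \<le> s \<Longrightarrow> s \<le> u \<Longrightarrow> u \<le> T \<Longrightarrow> \<bar>remainder s u\<bar> \<le> C * control s u"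
proof -
  obtain X where X: "compact X" "z ` {0..T} \<subseteq> X"
    "\<forall>s u. 0 \<le> s \<longrightarrow> s \<le> u \<longrightarrow> u \<le> T \<longrightarrow> (\<exists>p\<in>X. \<exists>q\<in>X. remainder s u = taylor_term p q s u \<and>
      dist p (z s) \<le> 2 * dist (z u) (z s) \<and> dist q (z s) \<le> 2 * dist (z u) (z s))"
    using remainder_eq_taylor_term by blast
  have "bounded (coeffs ` X)"
    using X(1) coeffs_cont by (intro compact_imp_bounded compact_continuous_image)
  then obtain B where B: "B > 0" "\<And>p. p \<in> X \<Longrightarrow> norm (coeffs p) \<le> B"
    unfolding bounded_pos by auto
  show thesis
  proof (rule that[of "B * real (CARD('m) + CARD('d))"])
    fix s u :: real assume su: "0 \<le> s" "s \<le> u" "u \<le> T"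
    then obtain p q where "p \<in> X" "q \<in> X" "remainder s u = taylor_term p q s u"
      using X(3) by blast
    then show "\<bar>remainder s u\<bar> \<le> B * real (CARD('m) + CARD('d)) * control s u"
      using taylor_term_bound[OF B(2) B(2) su] by simp
  qed (use B(1) in simp)
qed

text \<open>Shifting both base points to \<open>z s\<close> changes the coefficients by little,
  uniformly on short cells, since \<open>coeffs\<close> is uniformly continuous on the compact set
  \<open>X\<close> and \<open>z\<close> on \<open>{0..T}\<close>.\<close>

lemma remainder_approx:
  assumes "0 < e"
  obtains \<delta> where "0 < \<delta>" "\<And>s u. 0 \<le> s \<Longrightarrow> s \<le> u \<Longrightarrow> u \<le> T \<Longrightarrow> u - s < \<delta> \<Longrightarrow>
    \<bar>remainder s u - taylor_term (z s) (z s) s u\<bar> \<le> e * control s u"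
proof -
  obtain X where X: "compact X" "z ` {0..T} \<subseteq> X"
    "\<forall>s u. 0 \<le> s \<longrightarrow> s \<le> u \<longrightarrow> u \<le> T \<longrightarrow> (\<exists>p\<in>X. \<exists>q\<in>X. remainder s u = taylor_term p q s u \<and>
      dist p (z s) \<le> 2 * dist (z u) (z s) \<and> dist q (z s) \<le> 2 * dist (z u) (z s))"
    using remainder_eq_taylor_term by blast
  define N where "N = real (CARD('m) + CARD('d))"
  have N: "0 < N" by (simp add: N_def add_pos_pos)
  have "uniformly_continuous_on X coeffs"
    using X(1) coeffs_cont by (intro compact_uniformly_continuous)
  moreover have "0 < e / N" using assms N by simp
  ultimately obtain \<rho> where rho: "0 < \<rho>"
    "\<And>x y. x \<in> X \<Longrightarrow> y \<in> X \<Longrightarrow> dist y x < \<rho> \<Longrightarrow> dist (coeffs y) (coeffs x) < e / N"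
    unfolding uniformly_continuous_on_def by metis
  obtain \<delta> where d: "0 < \<delta>" "\<And>s u. 0 \<le> s \<Longrightarrow> s \<le> u \<Longrightarrow> u \<le> T \<Longrightarrow> u - s < \<delta> \<Longrightarrow> dist (z u) (z s) < \<rho> / 2"
    using uniform_modulus[OF z_cont, of "\<rho> / 2"] rho by auto
  have "\<bar>remainder s u - taylor_term (z s) (z s) s u\<bar> \<le> e * control s u"
    if su: "0 \<le> s" "s \<le> u" "u \<le> T" "u - s < \<delta>" for s u
  proof -
    obtain p q where pq: "p \<in> X" "q \<in> X" "remainder s u = taylor_term p q s u"
      "dist p (z s) \<le> 2 * dist (z u) (z s)" "dist q (z s) \<le> 2 * dist (z u) (z s)"
      using X(3) su by blast
    have zs: "z s \<in> X" using X(2) su by auto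
    have "dist p (z s) < \<rho>" "dist q (z s) < \<rho>" using pq d(2)[OF su] by auto
    then have "norm (coeffs p - coeffs (z s)) \<le> e / N" "norm (coeffs q - coeffs (z s)) \<le> e / N"
      unfolding dist_norm[symmetric]
      using rho(2)[OF zs pq(1)] rho(2)[OF zs pq(2)] by (simp_all add: less_imp_le)
    from taylor_term_diff_bound[OF this su(1-3)] show ?thesis using N by (simp add: pq N_def)
  qed
  with d(1) show thesis using that by blast
qed

section \<open>Limits of sums along the partitions and the pathwise Ito formula\<close>

lemma covariation_limit:
  assumes "t \<in> {0..T}"
  shows "(\<lambda>n. cell_sum (trunc P t n) (\<lambda>s u. (\<mu> u $ i - \<mu> s $ i) * (\<mu> u $ j - \<mu> s $ j)))
    \<longlonglongrightarrow> covariation P (\<lambda>s. \<mu> s $ i) (\<lambda>s. \<mu> s $ j) t"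
proof -
  have "covariation_sum (P n) (\<lambda>s. \<mu> s $ i) (\<lambda>s. \<mu> s $ j) t =
    cell_sum (trunc P t n) (\<lambda>s u. (\<mu> u $ i - \<mu> s $ i) * (\<mu> u $ j - \<mu> s $ j))" for n
    unfolding covariation_sum_def by (rule sum_cells_trunc[OF partitions assms]) simp
  moreover have "convergent (\<lambda>n. covariation_sum (P n) (\<lambda>s. \<mu> s $ i) (\<lambda>s. \<mu> s $ j) t)"
    using covariations assms by (simp add: has_covariations_def)
  ultimately show ?thesis
    unfolding covariation_def by (simp add: convergent_LIMSEQ_iff)
qed

lemma cell_sum_trunc_telescope:
  "t \<in> {0..T} \<Longrightarrow> cell_sum (trunc P t n) (\<lambda>s u. f u - f s) = f t - f 0"
  using trunc_props[OF partitions] by (simp add: cell_sum_telescope)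

lemma control_sum_limit:
  assumes "t \<in> {0..T}"
  shows "(\<lambda>n. cell_sum (trunc P t n) control) \<longlonglongrightarrow> control_limit t"
proof -
  have "cell_sum (trunc P t n) control =
    (total_variation {0..t} A - total_variation {0..0} A) +
    (\<Sum>i\<in>UNIV. cell_sum (trunc P t n) (\<lambda>s u. (\<mu> u $ i - \<mu> s $ i) * (\<mu> u $ i - \<mu> s $ i)))" for n
    unfolding control_def[abs_def] power2_eq_square
    by (simp only: cell_sum_add cell_sum_sum
        cell_sum_trunc_telescope[OF assms, of n "\<lambda>t. total_variation {0..t} A"])
  then show ?thesis
    unfolding control_limit_def using covariation_limit[OF assms] by (simp add: tendsto_intros)
qed

lemma control_limit_cont: "continuous_on {0..T} control_limit"
  unfolding control_limit_def[abs_def]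
  using covariations by (intro continuous_intros total_variation_A_cont) (auto simp: has_covariations_def)

lemma cell_sum_bounded:
  assumes t: "t \<in> {0..T}" and "0 \<le> C"
    and "\<And>s u. 0 \<le> s \<Longrightarrow> s \<le> u \<Longrightarrow> u \<le> T \<Longrightarrow> \<bar>w s u\<bar> \<le> C * control s u"
  shows "\<forall>\<^sub>F n in sequentially. cell_sum (trunc P t n) (\<lambda>s u. \<bar>w s u\<bar>) \<le> C * (control_limit t + 1)"
proof -
  have "\<forall>\<^sub>F n in sequentially. cell_sum (trunc P t n) control < control_limit t + 1"
    using control_sum_limit[OF t] by (rule order_tendstoD) simp
  then show ?thesis
  proof eventually_elim
    case (elim n)
    have "cell_sum (trunc P t n) (\<lambda>s u. \<bar>w s u\<bar>) \<le> cell_sum (trunc P t n) (\<lambda>s u. C * control s u)"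
    proof (rule cell_sum_mono)
      fix s u assume "(s, u) \<in> cells (trunc P t n)"
      then have "s < u" "s \<in> trunc P t n" "u \<in> trunc P t n" by (auto simp: cells_def)
      then show "\<bar>w s u\<bar> \<le> C * control s u"
        using trunc_props(4)[OF partitions t, of n] t by (intro assms(3)) auto
    qed
    also have "\<dots> = C * cell_sum (trunc P t n) control" by (rule cell_sum_mult)
    also have "\<dots> \<le> C * (control_limit t + 1)" using elim assms(2) by (intro mult_left_mono) auto
    finally show ?case .
  qed
qed

text \<open>A weight that is little-o of \<open>K\<close> on short cells vanishes in the limit as
  soon as the sums of \<open>K\<close> stay bounded. It is used with \<open>K\<close> equal to
  \<open>control\<close> and to the increments of \<open>v\<close>.\<close>

lemma cell_sum_negligible:
  assumes t: "t \<in> {0..T}"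
    and small: "\<And>e. 0 < e \<Longrightarrow> \<exists>\<delta>>0. \<forall>s u. 0 \<le> s \<longrightarrow> s \<le> u \<longrightarrow> u \<le> T \<longrightarrow> u - s < \<delta> \<longrightarrow> \<bar>w s u\<bar> \<le> e * K s u"
    and K: "\<forall>\<^sub>F n in sequentially. cell_sum (trunc P t n) K \<le> B"
  shows "(\<lambda>n. cell_sum (trunc P t n) w) \<longlonglongrightarrow> 0"
proof (rule tendstoI)
  fix e :: real assume e: "0 < e"
  define e' where "e' = e / (\<bar>B\<bar> + 1)"
  have "0 < e'" using e by (simp add: e'_def)
  then obtain \<delta> where d: "\<delta> > 0" "\<And>s u. 0 \<le> s \<Longrightarrow> s \<le> u \<Longrightarrow> u \<le> T \<Longrightarrow> u - s < \<delta> \<Longrightarrow> \<bar>w s u\<bar> \<le> e' * K s u"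
    using small by metis
  show "\<forall>\<^sub>F n in sequentially. dist (cell_sum (trunc P t n) w) 0 < e"
    using K trunc_fine[OF partitions d(1)]
  proof eventually_elim
    case (elim n)
    have "\<bar>cell_sum (trunc P t n) w\<bar> \<le> cell_sum (trunc P t n) (\<lambda>s u. \<bar>w s u\<bar>)" by (rule cell_sum_abs)
    also have "\<dots> \<le> cell_sum (trunc P t n) (\<lambda>s u. e' * K s u)"
    proof (rule cell_sum_mono)
      fix s u assume su: "(s, u) \<in> cells (trunc P t n)"
      then have "s < u" "s \<in> trunc P t n" "u \<in> trunc P t n" by (auto simp: cells_def)
      moreover have "u - s < \<delta>" using elim(2) t su by blast
      ultimately show "\<bar>w s u\<bar> \<le> e' * K s u"
        using trunc_props(4)[OF partitions t, of n] t by (intro d(2)) auto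
    qed
    also have "\<dots> = e' * cell_sum (trunc P t n) K" by (rule cell_sum_mult)
    also have "\<dots> \<le> e' * \<bar>B\<bar>" using elim(1) \<open>0 < e'\<close> by (intro mult_left_mono) auto
    also have "\<dots> < e" using e by (simp add: e'_def field_simps)
    finally show ?case by simp
  qed
qed

text \<open>Each summand is a continuous function of the left end times an increment whose plain
  sums converge: by telescoping for \<open>A\<close>, by the covariation assumption for
  \<open>\<mu>\<close>. Absolute sums are bounded through \<open>control\<close>.\<close>

lemma taylor_sum_convergent:
  assumes t: "t \<in> {0..T}"
  shows "convergent (\<lambda>n. cell_sum (trunc P t n) (\<lambda>s u. taylor_term (z s) (z s) s u))"
proof -
  have zt: "continuous_on {0..t} z" using z_cont t by (auto intro: continuous_on_subset)
  have 1: "convergent (\<lambda>n. cell_sum (trunc P t n)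
      (\<lambda>s u. dir_deriv (unit_a k) G (z s) * (A u $ k - A s $ k)))" for k
  proof (rule weighted_cell_sum_limit[OF partitions t])
    show "continuous_on {0..t} (\<lambda>s. dir_deriv (unit_a k) G (z s))"
      by (rule continuous_on_compose2[OF dir_deriv_cont(2) zt]) (rule subset_refl)
    show "\<forall>\<^sub>F n in sequentially. cell_sum (trunc P t n) (\<lambda>s u. \<bar>A u $ k - A s $ k\<bar>) \<le> 1 * (control_limit t + 1)"
    proof (rule cell_sum_bounded[OF t])
      fix s u :: real assume su: "0 \<le> s" "s \<le> u" "u \<le> T"
      have "\<bar>A u $ k - A s $ k\<bar> \<le> norm (A u - A s)"
        using component_le_norm_cart[of "A u - A s" k] by simp
      also have "\<dots> \<le> total_variation {0..u} A - total_variation {0..s} A"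
        by (rule norm_diff_le_total_variation[OF A_props(2) su])
      also have "\<dots> \<le> 1 * control s u" by (simp add: control_def sum_nonneg)
      finally show "\<bar>A u $ k - A s $ k\<bar> \<le> 1 * control s u" .
    qed simp
    show "(\<lambda>n. cell_sum (trunc P q n) (\<lambda>s u. A u $ k - A s $ k)) \<longlonglongrightarrow> A q $ k - A 0 $ k"
      if "q \<in> {0..t}" for q
      using that t by (simp add: cell_sum_trunc_telescope[where f = "\<lambda>s. A s $ k"])
  qed (auto intro: convergentI)
  have 2: "convergent (\<lambda>n. cell_sum (trunc P t n) (\<lambda>s u.
      dir_deriv (unit_x j) (partial_x i G) (z s) * ((\<mu> u $ i - \<mu> s $ i) * (\<mu> u $ j - \<mu> s $ j))))" for i j
  proof (rule weighted_cell_sum_limit[OF partitions t])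
    show "continuous_on {0..t} (\<lambda>s. dir_deriv (unit_x j) (partial_x i G) (z s))"
      by (rule continuous_on_compose2[OF dir_deriv_cont(3) zt]) (rule subset_refl)
    show "\<forall>\<^sub>F n in sequentially. cell_sum (trunc P t n)
        (\<lambda>s u. \<bar>(\<mu> u $ i - \<mu> s $ i) * (\<mu> u $ j - \<mu> s $ j)\<bar>) \<le> 1 * (control_limit t + 1)"
    proof (rule cell_sum_bounded[OF t])
      fix s u :: real assume su: "0 \<le> s" "s \<le> u" "u \<le> T"
      let ?b = "\<mu> u - \<mu> s"
      have "\<bar>?b $ i * ?b $ j\<bar> \<le> ((?b $ i)\<^sup>2 + (?b $ j)\<^sup>2) / 2"
        using sum_squares_bound[of "\<bar>?b $ i\<bar>" "\<bar>?b $ j\<bar>"] by (simp add: abs_mult)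
      moreover have "(?b $ l)\<^sup>2 \<le> (\<Sum>l\<in>UNIV. (?b $ l)\<^sup>2)" for l
        by (rule member_le_sum) auto
      from add_mono[OF this[of i] this[of j]]
      have "((?b $ i)\<^sup>2 + (?b $ j)\<^sup>2) / 2 \<le> (\<Sum>l\<in>UNIV. (?b $ l)\<^sup>2)"
        by simp
      ultimately show "\<bar>(\<mu> u $ i - \<mu> s $ i) * (\<mu> u $ j - \<mu> s $ j)\<bar> \<le> 1 * control s u"
        using total_variation_mono[OF A_props(2) su] by (simp add: control_def)
    qed simp
    show "(\<lambda>n. cell_sum (trunc P q n) (\<lambda>s u. (\<mu> u $ i - \<mu> s $ i) * (\<mu> u $ j - \<mu> s $ j)))
      \<longlonglongrightarrow> covariation P (\<lambda>s. \<mu> s $ i) (\<lambda>s. \<mu> s $ j) q" if "q \<in> {0..t}" for q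
      using that t by (intro covariation_limit) auto
  qed (auto intro: convergentI)
  have "(\<lambda>s u. taylor_term (z s) (z s) s u) = (\<lambda>s u.
      (\<Sum>k\<in>UNIV. dir_deriv (unit_a k) G (z s) * (A u $ k - A s $ k)) +
      (1 / 2) * (\<Sum>i\<in>UNIV. \<Sum>j\<in>UNIV. dir_deriv (unit_x j) (partial_x i G) (z s) *
      ((\<mu> u $ i - \<mu> s $ i) * (\<mu> u $ j - \<mu> s $ j))))"
    by (simp add: taylor_term_def)
  then show ?thesis
    by (simp only: cell_sum_add cell_sum_mult cell_sum_sum)
      (intro convergent_add convergent_mult convergent_const convergent_sum 1 2)
qed

lemma remainder_sum_convergent:
  assumes t: "t \<in> {0..T}"
  shows "convergent (\<lambda>n. cell_sum (trunc P t n) remainder)"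
proof -
  have "(\<lambda>n. cell_sum (trunc P t n) (\<lambda>s u. remainder s u - taylor_term (z s) (z s) s u)) \<longlonglongrightarrow> 0"
  proof (rule cell_sum_negligible[OF t])
    show "\<exists>\<delta>>0. \<forall>s u. 0 \<le> s \<longrightarrow> s \<le> u \<longrightarrow> u \<le> T \<longrightarrow> u - s < \<delta> \<longrightarrow>
        \<bar>remainder s u - taylor_term (z s) (z s) s u\<bar> \<le> e * control s u" if "0 < e" for e
      using remainder_approx[OF that] by metis
    have "\<forall>\<^sub>F n in sequentially. cell_sum (trunc P t n) control < control_limit t + 1"
      using control_sum_limit[OF t] by (rule order_tendstoD) simp
    then show "\<forall>\<^sub>F n in sequentially. cell_sum (trunc P t n) control \<le> control_limit t + 1"
      by (auto elim: eventually_mono)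
  qed
  then have "convergent (\<lambda>n. cell_sum (trunc P t n) (\<lambda>s u. remainder s u - taylor_term (z s) (z s) s u)
      + cell_sum (trunc P t n) (\<lambda>s u. taylor_term (z s) (z s) s u))"
    by (intro convergent_add taylor_sum_convergent[OF t] convergentI)
  then show ?thesis by (simp add: cell_sum_diff)
qed

lemma pathwise_integral_eq:
  assumes "t \<in> {0..T}"
  shows "pathwise_integral P \<theta> \<mu> t =
    lim (\<lambda>n. cell_sum (trunc P t n) (\<lambda>s u. \<Sum>i\<in>UNIV. \<theta> s $ i * (\<mu> u $ i - \<mu> s $ i)))"
  unfolding pathwise_integral_def
  by (subst sum_cells_trunc[OF partitions assms, where w = "\<lambda>s u. \<Sum>i\<in>UNIV. \<theta> s $ i * (\<mu> u $ i - \<mu> s $ i)"]) auto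

abbreviation \<Gamma> :: "real \<Rightarrow> real" where
  "\<Gamma> \<equiv> Gamma_proc P \<mu> A G"

text \<open>The increments of \<open>G\<close> along the path telescope, so the remainder sums and
  the sums defining the pathwise integral converge together. Only this makes the \<open>lim\<close>
  inside \<open>\<Gamma>\<close> a genuine limit.\<close>

lemma remainder_sum_limit:
  assumes t: "t \<in> {0..T}"
  shows "(\<lambda>n. cell_sum (trunc P t n) remainder) \<longlonglongrightarrow> - \<Gamma> t"
proof -
  let ?I = "\<lambda>n. cell_sum (trunc P t n)
    (\<lambda>s u. \<Sum>i\<in>UNIV. (\<chi> i. partial_x i G (\<mu> s, A s)) $ i * (\<mu> u $ i - \<mu> s $ i))"
  have eq: "cell_sum (trunc P t n) remainder = G (z t) - G (z 0) - ?I n" for n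
    unfolding remainder_def[abs_def]
    using cell_sum_trunc_telescope[OF t, of n "\<lambda>s. G (z s)"]
    by (simp only: cell_sum_diff[of _ "\<lambda>s u. G (z u) - G (z s)"]) (simp add: z_def)
  obtain L where L: "(\<lambda>n. cell_sum (trunc P t n) remainder) \<longlonglongrightarrow> L"
    using remainder_sum_convergent[OF t] by (auto simp: convergent_def)
  have "(\<lambda>n. G (z t) - G (z 0) - cell_sum (trunc P t n) remainder) \<longlonglongrightarrow> G (z t) - G (z 0) - L"
    by (intro tendsto_intros L)
  then have "?I \<longlonglongrightarrow> G (z t) - G (z 0) - L" by (simp add: eq)
  then have "\<Gamma> t = - L"
    unfolding Gamma_proc_def pathwise_integral_eq[OF t] by (simp add: limI z_def)
  with L show ?thesis by simp
qed

text \<open>\<open>cell_sum_limit_mono\<close> is applied to \<open>C * control + remainder\<close>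
  and \<open>C * control - remainder\<close>, which are nonnegative and at most
  \<open>2 * C * control\<close>; the latter is small on short cells.\<close>

lemma Gamma_increment_bound:
  obtains C where "\<And>s t. 0 \<le> s \<Longrightarrow> s \<le> t \<Longrightarrow> t \<le> T \<Longrightarrow>
    \<bar>\<Gamma> t - \<Gamma> s\<bar> \<le> C * (control_limit t - control_limit s)"
proof -
  obtain C where C: "0 \<le> C" "\<And>s u. 0 \<le> s \<Longrightarrow> s \<le> u \<Longrightarrow> u \<le> T \<Longrightarrow> \<bar>remainder s u\<bar> \<le> C * control s u"
    using remainder_bound by blast
  have small: "\<exists>\<delta>>0. \<forall>s u. 0 \<le> s \<longrightarrow> s < u \<longrightarrow> u \<le> T \<longrightarrow> u - s < \<delta> \<longrightarrow> 2 * C * control s u \<le> e"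
    if e: "0 < e" for e
  proof -
    define f where "f s = (total_variation {0..s} A, \<mu> s)" for s
    have "continuous_on {0..T} f"
      unfolding f_def[abs_def] by (intro continuous_intros total_variation_A_cont mu_cont)
    \<comment> \<open>If \<open>?d\<close> is below 1, a square of an increment is at most
      \<open>?d\<close>, so \<open>control s u\<close> is at most
      \<open>(1 + real CARD('d)) * ?d\<close>. The final summand 1 keeps \<open>N\<close> positive
      when \<open>C\<close> is 0.\<close>
    define N where "N = 2 * C * (1 + real CARD('d)) + 1"
    have N: "0 < N" using C by (simp add: N_def add_nonneg_pos)
    have "0 < min 1 (e / N)" using e N by simp
    then obtain \<delta> where d: "0 < \<delta>" "\<And>s u. 0 \<le> s \<Longrightarrow> s \<le> u \<Longrightarrow> u \<le> T \<Longrightarrow> u - s < \<delta> \<Longrightarrow>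
        dist (f u) (f s) < min 1 (e / N)"
      using uniform_modulus[OF \<open>continuous_on {0..T} f\<close>] by metis
    have "2 * C * control s u \<le> e" if su: "0 \<le> s" "s < u" "u \<le> T" "u - s < \<delta>" for s u
    proof -
      let ?d = "dist (f u) (f s)"
      have d1: "?d < 1" "?d < e / N" using d(2)[of s u] su by auto
      have "total_variation {0..u} A - total_variation {0..s} A \<le> ?d"
        using norm_fst_le[of "total_variation {0..u} A - total_variation {0..s} A" "\<mu> u - \<mu> s"]
        by (simp add: dist_norm f_def)
      moreover have "norm (\<mu> u - \<mu> s) \<le> ?d"
        using norm_snd_le[of "\<mu> u - \<mu> s" "total_variation {0..u} A - total_variation {0..s} A"]
        by (simp add: dist_norm f_def)
      then have le: "\<bar>\<mu> u $ i - \<mu> s $ i\<bar> \<le> ?d" for i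
        using component_le_norm_cart[of "\<mu> u - \<mu> s" i] by simp
      have "(\<mu> u $ i - \<mu> s $ i)\<^sup>2 \<le> ?d" for i
      proof -
        have "(\<mu> u $ i - \<mu> s $ i)\<^sup>2 \<le> ?d\<^sup>2"
          using power_mono[OF le[of i] abs_ge_zero, where n = 2] by (simp only: power2_abs)
        also have "?d\<^sup>2 \<le> ?d" using mult_left_le[of ?d ?d] d1(1) by (simp only: power2_eq_square zero_le_dist less_imp_le)
        finally show ?thesis .
      qed
      then have "(\<Sum>i\<in>UNIV. (\<mu> u $ i - \<mu> s $ i)\<^sup>2) \<le> real CARD('d) * ?d"
        by (rule sum_bounded_above)
      ultimately have "control s u \<le> (1 + real CARD('d)) * ?d"
        unfolding control_def distrib_right by linarith
      then have "2 * C * control s u \<le> 2 * C * ((1 + real CARD('d)) * ?d)"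
        using C by (intro mult_left_mono) auto
      also have "\<dots> = (2 * C * (1 + real CARD('d))) * ?d" by (simp only: mult.assoc)
      also have "\<dots> \<le> N * ?d" by (rule mult_right_mono) (simp_all add: N_def)
      also have "\<dots> \<le> e" using d1(2) N by (simp add: pos_less_divide_eq mult.commute less_imp_le)
      finally show ?thesis .
    qed
    with d(1) show ?thesis by blast
  qed
  have lim: "(\<lambda>n. cell_sum (trunc P q n) (\<lambda>s u. C * control s u + k * remainder s u))
      \<longlonglongrightarrow> C * control_limit q - k * \<Gamma> q" if "q \<in> {0..T}" for q k
    using tendsto_add[OF tendsto_mult_left[OF control_sum_limit[OF that], of C]
        tendsto_mult_left[OF remainder_sum_limit[OF that], of k]]
    by (simp add: cell_sum_add cell_sum_mult)
  have le: "C * control_limit s - k * \<Gamma> s \<le> C * control_limit t - k * \<Gamma> t"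
    if st: "0 \<le> s" "s \<le> t" "t \<le> T" and k: "k = 1 \<or> k = -1" for s t k
  proof (rule cell_sum_limit_mono[OF partitions st _ _ lim])
    show "0 \<le> C * control p q + k * remainder p q" if "0 \<le> p" "p < q" "q \<le> T" for p q
      using C(2)[of p q] that k by (auto simp: abs_le_iff)
    show "\<exists>\<delta>>0. \<forall>p q. 0 \<le> p \<longrightarrow> p < q \<longrightarrow> q \<le> T \<longrightarrow> q - p < \<delta> \<longrightarrow>
        C * control p q + k * remainder p q \<le> e" if e: "0 < e" for e
    proof -
      have "C * control p q + k * remainder p q \<le> 2 * C * control p q" if "0 \<le> p" "p < q" "q \<le> T" for p q
        using C(2)[of p q] that k by (auto simp: abs_le_iff)
      with small[OF e] show ?thesis by (meson order_trans)
    qed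
  qed
  have "\<bar>\<Gamma> t - \<Gamma> s\<bar> \<le> C * (control_limit t - control_limit s)" if "0 \<le> s" "s \<le> t" "t \<le> T" for s t
    using le[OF that, of 1] le[OF that, of "-1"] by (simp add: algebra_simps abs_le_iff)
  then show thesis using that by blast
qed

lemma Gamma_cont: "continuous_on {0..T} \<Gamma>"
  unfolding continuous_on_iff
proof (intro ballI allI impI)
  fix x e :: real assume x: "x \<in> {0..T}" and e: "0 < e"
  obtain C where C: "\<And>s t. 0 \<le> s \<Longrightarrow> s \<le> t \<Longrightarrow> t \<le> T \<Longrightarrow>
    \<bar>\<Gamma> t - \<Gamma> s\<bar> \<le> C * (control_limit t - control_limit s)" using Gamma_increment_bound by blast
  have "continuous_on {0..T} (\<lambda>t. C * control_limit t)"
    by (intro continuous_intros control_limit_cont)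
  then obtain d where d: "d > 0" "\<And>y. y \<in> {0..T} \<Longrightarrow> dist y x < d \<Longrightarrow>
      dist (C * control_limit y) (C * control_limit x) < e"
    using x e unfolding continuous_on_iff by metis
  have "dist (\<Gamma> y) (\<Gamma> x) < e" if y: "y \<in> {0..T}" "dist y x < d" for y
    using d(2)[OF y] C[of x y] C[of y x] x y
    by (cases "x \<le> y") (auto simp: dist_real_def algebra_simps abs_minus_commute)
  with d(1) show "\<exists>d>0. \<forall>x'\<in>{0..T}. dist x' x < d \<longrightarrow> dist (\<Gamma> x') (\<Gamma> x) < e" by blast
qed

end

section \<open>The multiplicatively generated strategy\<close>

lemma abs_exp_minus_one_minus_le:
  fixes x :: real
  assumes "\<bar>x\<bar> \<le> 1"
  shows "\<bar>exp x - 1 - x\<bar> \<le> x\<^sup>2"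
proof -
  have "exp x \<le> 1 + x + x\<^sup>2"
  proof (cases "0 \<le> x")
    case True
    then show ?thesis using assms by (intro exp_bound) auto
  next
    case False
    \<comment> \<open>For negative \<open>x\<close> the bound comes from
      \<open>1 - x \<le> exp (- x)\<close> and the factorization of \<open>1 - x ^ 3\<close>, which
      is at least 1.\<close>
    have "0 \<le> 1 + x + x\<^sup>2" using assms by (simp add: abs_le_iff)
    moreover have "1 - x \<le> exp (- x)" using exp_ge_add_one_self[of "- x"] by simp
    ultimately have "(1 + x + x\<^sup>2) * (1 - x) \<le> (1 + x + x\<^sup>2) * exp (- x)"
      by (intro mult_left_mono)
    moreover have "(1 + x + x\<^sup>2) * (1 - x) = 1 - x ^ 3"
      by (simp add: algebra_simps power2_eq_square power3_eq_cube)
    moreover have "x ^ 3 \<le> 0" using False by (simp add: power_le_zero_eq)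
    ultimately have "1 \<le> (1 + x + x\<^sup>2) * exp (- x)" by linarith
    then have "1 * exp x \<le> (1 + x + x\<^sup>2) * exp (- x) * exp x" by (intro mult_right_mono) auto
    then show ?thesis by (simp add: mult.assoc exp_minus)
  qed
  then show ?thesis using exp_ge_add_one_self[of x] zero_le_power2[of x] by linarith
qed

locale regular_setting = ito_setting +
  assumes Gamma_BV: "bounded_variation_on {0..T} \<Gamma>"
    and G_nonzero: "t \<in> {0..T} \<Longrightarrow> G (z t) \<noteq> 0"
begin

definition v :: "real \<Rightarrow> real" where
  "v t = total_variation {0..t} \<Gamma>"

definition h :: "real \<Rightarrow> real" where
  "h t = stieltjes_integral (\<lambda>s. 1 / G (z s)) \<Gamma> t"

section \<open>The exponent \<open>h\<close> and the chain rule for its exponential\<close>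

lemma gen_exp_eq: "gen_exp P \<mu> A G t = exp (h t)"
  by (simp add: gen_exp_def h_def z_def)

lemma Gz_cont: "continuous_on {0..T} (\<lambda>s. G (z s))"
  by (rule continuous_on_compose2[OF G_cont[of UNIV] z_cont]) simp

lemma inverse_Gz_cont: "continuous_on {0..T} (\<lambda>s. 1 / G (z s))"
  by (intro continuous_intros Gz_cont ballI G_nonzero)

lemma bounded_on_interval:
  assumes "continuous_on {0..T} f"
  obtains B where "0 \<le> B" "\<And>s. s \<in> {0..T} \<Longrightarrow> \<bar>f s :: real\<bar> \<le> B"
proof -
  have "bounded (f ` {0..T})"
    using assms by (intro compact_imp_bounded compact_continuous_image) auto
  then obtain B where "B > 0" "\<forall>x\<in>f ` {0..T}. norm x \<le> B" unfolding bounded_pos by blast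
  then show thesis by (intro that[of B]) auto
qed

lemma v_cont: "continuous_on {0..T} v"
  unfolding v_def[abs_def] by (rule total_variation_continuous[OF Gamma_BV Gamma_cont])

lemma v_mono: "0 \<le> s \<Longrightarrow> s \<le> u \<Longrightarrow> u \<le> T \<Longrightarrow> v s \<le> v u"
  unfolding v_def by (rule total_variation_mono[OF Gamma_BV])

lemma h_increment:
  assumes "0 \<le> s" "s \<le> u" "u \<le> T" "\<And>x. x \<in> {s..u} \<Longrightarrow> \<bar>1 / G (z x) - c\<bar> \<le> e"
  shows "\<bar>h u - h s - c * (\<Gamma> u - \<Gamma> s)\<bar> \<le> e * (v u - v s)"
  unfolding h_def v_def
  by (rule stieltjes_integral_increment[OF Gamma_BV Gamma_cont inverse_Gz_cont assms])

lemma h_increment_bound: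
  obtains B where "0 \<le> B" "\<And>s u. 0 \<le> s \<Longrightarrow> s \<le> u \<Longrightarrow> u \<le> T \<Longrightarrow> \<bar>h u - h s\<bar> \<le> B * (v u - v s)"
proof -
  obtain B where B: "0 \<le> B" "\<And>s. s \<in> {0..T} \<Longrightarrow> \<bar>1 / G (z s)\<bar> \<le> B"
    using bounded_on_interval[OF inverse_Gz_cont] by blast
  have "\<bar>h u - h s\<bar> \<le> B * (v u - v s)" if "0 \<le> s" "s \<le> u" "u \<le> T" for s u
    using h_increment[OF that, of 0 B] B(2) that by simp
  with B(1) show thesis using that by blast
qed

lemma h_cont: "continuous_on {0..T} h"
  unfolding continuous_on_iff
proof (intro ballI allI impI)
  fix x e :: real assume x: "x \<in> {0..T}" and e: "0 < e"
  obtain B where B: "0 \<le> B" "\<And>s u. 0 \<le> s \<Longrightarrow> s \<le> u \<Longrightarrow> u \<le> T \<Longrightarrow> \<bar>h u - h s\<bar> \<le> B * (v u - v s)"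
    using h_increment_bound by blast
  have "continuous_on {0..T} (\<lambda>t. B * v t)" by (intro continuous_intros v_cont)
  then obtain d where d: "d > 0" "\<And>y. y \<in> {0..T} \<Longrightarrow> dist y x < d \<Longrightarrow> dist (B * v y) (B * v x) < e"
    using x e unfolding continuous_on_iff by metis
  have "dist (h y) (h x) < e" if y: "y \<in> {0..T}" "dist y x < d" for y
    using d(2)[OF y] B(2)[of x y] B(2)[of y x] x y
    by (cases "x \<le> y") (auto simp: dist_real_def algebra_simps abs_minus_commute)
  with d(1) show "\<exists>d>0. \<forall>x'\<in>{0..T}. dist x' x < d \<longrightarrow> dist (h x') (h x) < e" by blast
qed

lemma h_zero: "h 0 = 0"
  by (simp add: h_def stieltjes_integral_def set_lebesgue_integral_def)

text \<open>The chain rule \<open>G dE = E d\<Gamma>\<close> for \<open>E = exp h\<close> and \<open>dh = d\<Gamma> / G\<close>, on the level of increments.\<close>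

lemma exp_increment_approx:
  assumes "0 < e"
  shows "\<exists>\<delta>>0. \<forall>s u. 0 \<le> s \<longrightarrow> s \<le> u \<longrightarrow> u \<le> T \<longrightarrow> u - s < \<delta> \<longrightarrow>
    \<bar>G (z u) * (exp (h u) - exp (h s)) - exp (h s) * (\<Gamma> u - \<Gamma> s)\<bar> \<le> e * (v u - v s)"
proof -
  obtain B where B: "0 \<le> B" "\<And>s u. 0 \<le> s \<Longrightarrow> s \<le> u \<Longrightarrow> u \<le> T \<Longrightarrow> \<bar>h u - h s\<bar> \<le> B * (v u - v s)"
    using h_increment_bound by blast
  have "continuous_on {0..T} (\<lambda>s. exp (h s))" by (intro continuous_intros h_cont)
  then obtain ME where ME: "0 \<le> ME" "\<And>s. s \<in> {0..T} \<Longrightarrow> \<bar>exp (h s)\<bar> \<le> ME"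
    using bounded_on_interval by blast
  obtain MG where MG: "0 \<le> MG" "\<And>s. s \<in> {0..T} \<Longrightarrow> \<bar>G (z s)\<bar> \<le> MG"
    using bounded_on_interval[OF Gz_cont] by blast
  \<comment> \<open>The summands belong to three errors: the second order error of the exponential,
    the oscillation of \<open>G\<close>, and the deviation of the increment of \<open>h\<close> from
    that of \<open>\<Gamma>\<close> divided by \<open>G (z s)\<close>.\<close>
  define N where "N = ME * (MG * B + B + MG)"
  have N: "0 \<le> N" using ME MG B by (simp add: N_def)
  \<comment> \<open>The cap at 1 makes the quadratic bound for the exponential applicable to the
    increment of \<open>h\<close>.\<close>
  define e1 where "e1 = min 1 (e / (N + 1))"
  have e1: "0 < e1" "e1 \<le> 1" "e1 * N \<le> e"
  proof -
    show "0 < e1" "e1 \<le> 1" using assms N by (simp_all add: e1_def)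
    have "e1 * N \<le> e / (N + 1) * (N + 1)"
      using N assms by (intro mult_mono) (auto simp: e1_def)
    then show "e1 * N \<le> e" using N by simp
  qed
  have "continuous_on {0..T} (\<lambda>s. (h s, G (z s), 1 / G (z s)))"
    by (intro continuous_intros h_cont Gz_cont ballI G_nonzero)
  from uniform_modulus[OF this e1(1)] obtain \<delta> where d: "0 < \<delta>"
    "\<And>s u. 0 \<le> s \<Longrightarrow> s \<le> u \<Longrightarrow> u \<le> T \<Longrightarrow> u - s < \<delta> \<Longrightarrow>
      dist (h u, G (z u), 1 / G (z u)) (h s, G (z s), 1 / G (z s)) < e1" by blast
  have "\<bar>G (z u) * (exp (h u) - exp (h s)) - exp (h s) * (\<Gamma> u - \<Gamma> s)\<bar> \<le> e * (v u - v s)"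
    if su: "0 \<le> s" "s \<le> u" "u \<le> T" "u - s < \<delta>" for s u
  proof -
    define x where "x = h u - h s"
    define V where "V = v u - v s"
    have close: "\<bar>h y - h s\<bar> \<le> e1" "\<bar>G (z y) - G (z s)\<bar> \<le> e1" "\<bar>1 / G (z y) - 1 / G (z s)\<bar> \<le> e1"
      if y: "y \<in> {s..u}" for y
    proof -
      have *: "dist (h y, G (z y), 1 / G (z y)) (h s, G (z s), 1 / G (z s)) < e1"
        using d(2)[of s y] su y by auto
      note 1 = dist_fst_le[of "(h y, G (z y), 1 / G (z y))" "(h s, G (z s), 1 / G (z s))"]
      note 2 = dist_snd_le[of "(h y, G (z y), 1 / G (z y))" "(h s, G (z s), 1 / G (z s))"]
      note 3 = dist_fst_le[of "(G (z y), 1 / G (z y))" "(G (z s), 1 / G (z s))"]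
      note 4 = dist_snd_le[of "(G (z y), 1 / G (z y))" "(G (z s), 1 / G (z s))"]
      show "\<bar>h y - h s\<bar> \<le> e1" using * 1 unfolding fst_conv dist_real_def[symmetric] by linarith
      show "\<bar>G (z y) - G (z s)\<bar> \<le> e1"
        using * 2 3 unfolding fst_conv snd_conv dist_real_def[symmetric] by linarith
      show "\<bar>1 / G (z y) - 1 / G (z s)\<bar> \<le> e1"
        using * 2 4 unfolding fst_conv snd_conv dist_real_def[symmetric] by linarith
    qed
    have V: "0 \<le> V" using v_mono su by (simp add: V_def)
    have xV: "\<bar>x\<bar> \<le> B * V" using B(2) su by (simp add: x_def V_def)
    have xe: "\<bar>x\<bar> \<le> e1" using close(1)[of u] su by (simp add: x_def)
    have xg: "\<bar>x - 1 / G (z s) * (\<Gamma> u - \<Gamma> s)\<bar> \<le> e1 * V"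
      unfolding x_def V_def using h_increment[OF su(1-3) close(3)] by simp
    have Gu: "\<bar>G (z u) - G (z s)\<bar> \<le> e1" using close(2)[of u] su by simp
    have nz: "G (z s) \<noteq> 0" using G_nonzero su by simp
    have "exp (h u) = exp (h s) * exp x" by (simp add: x_def exp_diff)
    then have "G (z u) * (exp (h u) - exp (h s)) - exp (h s) * (\<Gamma> u - \<Gamma> s) =
      exp (h s) * (G (z u) * (exp x - 1 - x) + (G (z u) - G (z s)) * x
        + G (z s) * (x - 1 / G (z s) * (\<Gamma> u - \<Gamma> s)))"
      using nz by (simp add: algebra_simps)
    also have "\<bar>\<dots>\<bar> \<le> ME * (MG * (e1 * (B * V)) + e1 * (B * V) + MG * (e1 * V))"
      unfolding abs_mult[of "exp (h s)"]
    proof (rule mult_mono)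
      have "x\<^sup>2 = \<bar>x\<bar> * \<bar>x\<bar>" by (simp add: power2_eq_square)
      also have "\<dots> \<le> e1 * (B * V)" using xe xV e1 by (intro mult_mono) auto
      finally have "\<bar>exp x - 1 - x\<bar> \<le> e1 * (B * V)"
        using abs_exp_minus_one_minus_le[of x] xe e1 by linarith
      then have 1: "\<bar>G (z u) * (exp x - 1 - x)\<bar> \<le> MG * (e1 * (B * V))"
        unfolding abs_mult using MG su by (intro mult_mono) auto
      have 2: "\<bar>(G (z u) - G (z s)) * x\<bar> \<le> e1 * (B * V)"
        unfolding abs_mult using Gu xV e1 by (intro mult_mono) auto
      have 3: "\<bar>G (z s) * (x - 1 / G (z s) * (\<Gamma> u - \<Gamma> s))\<bar> \<le> MG * (e1 * V)"
        unfolding abs_mult[of "G (z s)"] using MG su xg by (intro mult_mono) auto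
      show "\<bar>G (z u) * (exp x - 1 - x) + (G (z u) - G (z s)) * x
        + G (z s) * (x - 1 / G (z s) * (\<Gamma> u - \<Gamma> s))\<bar> \<le>
        MG * (e1 * (B * V)) + e1 * (B * V) + MG * (e1 * V)"
        using 1 2 3 by linarith
    qed (use ME su in auto)
    also have "\<dots> = e1 * N * V" by (simp add: N_def algebra_simps)
    also have "\<dots> \<le> e * V" using e1(3) V by (rule mult_right_mono)
    finally show ?thesis by (simp add: V_def)
  qed
  with d(1) show ?thesis by blast
qed

lemma pathwise_integral_gen_eta:
  assumes t: "t \<in> {0..T}"
  shows "pathwise_integral P (gen_eta P \<mu> A G) \<mu> t = G (z t) * exp (h t) - G (z 0)"
proof -
  let ?E = "\<lambda>s. exp (h s)"
  let ?S = "\<lambda>n. cell_sum (trunc P t n)"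
  have E: "continuous_on {0..t} ?E"
    using h_cont t by (intro continuous_intros) (auto intro: continuous_on_subset)
  obtain C where C: "0 \<le> C" "\<And>s u. 0 \<le> s \<Longrightarrow> s \<le> u \<Longrightarrow> u \<le> T \<Longrightarrow> \<bar>remainder s u\<bar> \<le> C * control s u"
    using remainder_bound by blast
  \<comment> \<open>The same \<open>L\<close> for both sums is the point: the sums with the true
    remainder and with the increments of its limit \<open>- \<Gamma>\<close> cancel
    asymptotically.\<close>
  obtain L where L: "(\<lambda>n. ?S n (\<lambda>s u. ?E s * remainder s u)) \<longlonglongrightarrow> L"
    "(\<lambda>n. ?S n (\<lambda>s u. ?E s * (- \<Gamma> u - - \<Gamma> s))) \<longlonglongrightarrow> L"
  proof (rule weighted_cell_sum_limit[OF partitions t E cell_sum_bounded[OF t C]])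
    show "(\<lambda>n. cell_sum (trunc P q n) remainder) \<longlonglongrightarrow> - \<Gamma> q" if "q \<in> {0..t}" for q
      using that t by (intro remainder_sum_limit) auto
  qed
  have R: "(\<lambda>n. ?S n (\<lambda>s u. G (z u) * (?E u - ?E s) - ?E s * (\<Gamma> u - \<Gamma> s))) \<longlonglongrightarrow> 0"
  \<comment> \<open>The error is measured by increments of the variation \<open>v\<close>, whose
    sums telescope to a constant.\<close>
  proof (rule cell_sum_negligible[OF t exp_increment_approx])
    show "\<forall>\<^sub>F n in sequentially. ?S n (\<lambda>s u. v u - v s) \<le> v t - v 0"
      using cell_sum_trunc_telescope[OF t, where f = v] by simp
  qed
  let ?I = "\<lambda>s u. \<Sum>i\<in>UNIV. gen_eta P \<mu> A G s $ i * (\<mu> u $ i - \<mu> s $ i)"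
  have I: "?I s u = (G (z u) * ?E u - G (z s) * ?E s)
      - (G (z u) * (?E u - ?E s) - ?E s * (\<Gamma> u - \<Gamma> s))
      + ?E s * (- \<Gamma> u - - \<Gamma> s) - ?E s * remainder s u" for s u
  proof -
    have "?I s u = ?E s * (\<Sum>i\<in>UNIV. partial_x i G (z s) * (\<mu> u $ i - \<mu> s $ i))"
      by (simp add: gen_eta_def gen_exp_eq z_def sum_distrib_left mult_ac)
    also have "\<dots> = ?E s * (G (z u) - G (z s) - remainder s u)" by (simp add: remainder_def)
    finally show ?thesis by (simp add: algebra_simps)
  qed
  have "?S n ?I = (G (z t) * ?E t - G (z 0) * ?E 0)
      - ?S n (\<lambda>s u. G (z u) * (?E u - ?E s) - ?E s * (\<Gamma> u - \<Gamma> s))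
      + ?S n (\<lambda>s u. ?E s * (- \<Gamma> u - - \<Gamma> s)) - ?S n (\<lambda>s u. ?E s * remainder s u)" for n
    unfolding I
    by (simp only: cell_sum_diff[of _ "\<lambda>s u. _ s u + _ s u"] cell_sum_add
        cell_sum_diff[of _ "\<lambda>s u. G (z u) * ?E u - G (z s) * ?E s"]
        cell_sum_trunc_telescope[OF t, where f = "\<lambda>s. G (z s) * ?E s"])
  moreover have "(\<lambda>n. (G (z t) * ?E t - G (z 0) * ?E 0)
      - ?S n (\<lambda>s u. G (z u) * (?E u - ?E s) - ?E s * (\<Gamma> u - \<Gamma> s))
      + ?S n (\<lambda>s u. ?E s * (- \<Gamma> u - - \<Gamma> s)) - ?S n (\<lambda>s u. ?E s * remainder s u))
      \<longlonglongrightarrow> (G (z t) * ?E t - G (z 0) * ?E 0) - 0 + L - L"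
    by (intro tendsto_intros R L)
  ultimately have "(\<lambda>n. ?S n ?I) \<longlonglongrightarrow> G (z t) * ?E t - G (z 0)"
    by (simp add: h_zero)
  then show ?thesis unfolding pathwise_integral_eq[OF t] by (rule limI)
qed

text \<open>A continuous function without zeros keeps its initial sign.\<close>

lemma Gz_pos:
  assumes "t \<in> {0..T}" "0 < G (z 0)"
  shows "0 < G (z t)"
proof (rule ccontr)
  assume "\<not> 0 < G (z t)"
  then have "\<exists>x\<ge>0. x \<le> t \<and> G (z x) = 0"
    using assms by (intro IVT2' continuous_on_subset[OF Gz_cont]) auto
  then show False using G_nonzero assms(1) by force
qed

text \<open>All components are shifted by the same number, and the weights sum to 1, so the value
  shifts by that number.\<close>

lemma strategy_value_mult_generated_eta:
  assumes "(\<Sum>i\<in>UNIV. \<mu> t $ i) = 1"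
  shows "strategy_value (mult_generated P \<mu> A G) \<mu> t =
    strategy_value (gen_eta P \<mu> A G) \<mu> t - (sf_defect P (gen_eta P \<mu> A G) \<mu> t + gen_const \<mu> A G)"
proof -
  let ?c = "sf_defect P (gen_eta P \<mu> A G) \<mu> t + gen_const \<mu> A G"
  have "mult_generated P \<mu> A G t $ i * \<mu> t $ i = gen_eta P \<mu> A G t $ i * \<mu> t $ i - ?c * \<mu> t $ i" for i
    by (simp add: mult_generated_def algebra_simps)
  then have "strategy_value (mult_generated P \<mu> A G) \<mu> t =
      strategy_value (gen_eta P \<mu> A G) \<mu> t - ?c * (\<Sum>i\<in>UNIV. \<mu> t $ i)"
    by (simp only: strategy_value_def sum_subtractf sum_distrib_left)
  then show ?thesis using assms by simp
qed

text \<open>Subtracting the defect makes the strategy self-financing, so its value is initial value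
  plus pathwise integral. The constant \<open>gen_const\<close> is chosen to make the initial value
  \<open>G (z 0)\<close>, which cancels the \<open>- G (z 0)\<close> of the integral.\<close>

lemma strategy_value_mult_generated:
  assumes t: "t \<in> {0..T}" and one: "(\<Sum>i\<in>UNIV. \<mu> t $ i) = 1"
  shows "strategy_value (mult_generated P \<mu> A G) \<mu> t = G (z t) * exp (h t)"
proof -
  have "strategy_value (mult_generated P \<mu> A G) \<mu> t =
      strategy_value (gen_eta P \<mu> A G) \<mu> 0 + pathwise_integral P (gen_eta P \<mu> A G) \<mu> t
      - gen_const \<mu> A G"
    unfolding strategy_value_mult_generated_eta[OF one] by (simp add: sf_defect_def)
  also have "\<dots> = G (z t) * exp (h t)"
    unfolding pathwise_integral_gen_eta[OF t]
    by (simp add: strategy_value_def gen_eta_def gen_exp_eq h_zero gen_const_def z_def)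
  finally show ?thesis .
qed

text \<open>The shift common to all components equals the value of \<open>gen_eta\<close> minus the
  value of the strategy, and both are known.\<close>

lemma mult_generated_component:
  assumes t: "t \<in> {0..T}" and one: "(\<Sum>i\<in>UNIV. \<mu> t $ i) = 1"
  shows "mult_generated P \<mu> A G t $ i = G (z t) * exp (h t) *
    (1 + 1 / G (z t) * (partial_x i G (z t) - (\<Sum>j\<in>UNIV. \<mu> t $ j * partial_x j G (z t))))"
proof -
  let ?c = "sf_defect P (gen_eta P \<mu> A G) \<mu> t + gen_const \<mu> A G"
  let ?D = "\<Sum>j\<in>UNIV. \<mu> t $ j * partial_x j G (z t)"
  have "strategy_value (gen_eta P \<mu> A G) \<mu> t = exp (h t) * ?D"
    by (simp add: strategy_value_def gen_eta_def gen_exp_eq z_def sum_distrib_left mult_ac)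
  then have "?c = exp (h t) * ?D - G (z t) * exp (h t)"
    using strategy_value_mult_generated[OF t one] strategy_value_mult_generated_eta[OF one] by linarith
  then have eq: "mult_generated P \<mu> A G t $ i =
      partial_x i G (z t) * exp (h t) - (exp (h t) * ?D - G (z t) * exp (h t))"
    by (simp add: mult_generated_def gen_eta_def gen_exp_eq z_def)
  show ?thesis unfolding eq using G_nonzero[OF t] by (simp add: field_simps)
qed

end

theorem proposition3p9:
  fixes T :: real
    and P :: "nat \<Rightarrow> real set"
    and S \<mu> \<psi> :: "real \<Rightarrow> real^'d"
    and A :: "real \<Rightarrow> real^'m"
    and G :: "(real^'d) \<times> (real^'m) \<Rightarrow> real"
  assumes T_pos: "0 < T"
    and d_ge_2: "2 \<le> CARD('d)"
    and partitions: "refining_partitions T P"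
    and S_cont: "\<And>i. continuous_on {0..T} (\<lambda>t. S t $ i)"
    and S_nonneg: "\<And>i t. t \<in> {0..T} \<Longrightarrow> 0 \<le> S t $ i"
    and S_init: "\<And>i. 0 < S 0 $ i"
    and S_total: "\<And>t. t \<in> {0..T} \<Longrightarrow> 0 < (\<Sum>k\<in>UNIV. S t $ k)"
    and weights: "\<And>i t. t \<in> {0..T} \<Longrightarrow> \<mu> t $ i = S t $ i / (\<Sum>k\<in>UNIV. S t $ k)"
    and covariations: "has_covariations T P \<mu>"
    and A_cbv: "A \<in> CBV T"
    and regular: "regular_for T P \<mu> A G"
    and G_nonzero: "\<And>t. t \<in> {0..T} \<Longrightarrow> G (\<mu> t, A t) \<noteq> 0"
    and inverse_bounded: "locally_bounded_on {0..T} (\<lambda>t. 1 / G (\<mu> t, A t))"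
    and generated: "\<And>t. t \<in> {0..T} \<Longrightarrow> \<psi> t = mult_generated P \<mu> A G t"
  shows "\<forall>t\<in>{0..T}.
           strategy_value \<psi> \<mu> t =
             G (\<mu> t, A t) * exp (stieltjes_integral (\<lambda>s. 1 / G (\<mu> s, A s)) (Gamma_proc P \<mu> A G) t) \<and>
           (0 < G (\<mu> 0, A 0) \<longrightarrow> 0 < strategy_value \<psi> \<mu> t) \<and>
           (\<forall>i. \<psi> t $ i = strategy_value \<psi> \<mu> t *
             (1 + 1 / G (\<mu> t, A t) *
               (partial_x i G (\<mu> t, A t) - (\<Sum>j\<in>UNIV. \<mu> t $ j * partial_x j G (\<mu> t, A t)))))"
proof -
  have "continuous_on {0..T} (\<lambda>t. \<chi> i. S t $ i / (\<Sum>k\<in>UNIV. S t $ k))"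
    using S_total by (intro continuous_intros S_cont) (metis less_irrefl)
  then have mu_cont: "continuous_on {0..T} \<mu>"
    by (rule continuous_on_eq) (simp add: vec_eq_iff weights)
  have ito: "ito_setting T P \<mu> A G"
    by unfold_locales
      (use partitions mu_cont covariations A_cbv regular in \<open>auto simp: regular_for_def\<close>)
  interpret regular_setting T P \<mu> A G
    using ito by (intro regular_setting.intro regular_setting_axioms.intro)
      (use regular G_nonzero in \<open>auto simp: regular_for_def ito_setting.z_def[OF ito]\<close>)
  show ?thesis
  proof (intro ballI conjI impI allI)
    fix t assume t: "t \<in> {0..T}"
    have one: "(\<Sum>i\<in>UNIV. \<mu> t $ i) = 1"
      using S_total[OF t] by (simp add: weights[OF t] sum_divide_distrib[symmetric])
    have "strategy_value \<psi> \<mu> t = strategy_value (mult_generated P \<mu> A G) \<mu> t"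
      by (simp add: strategy_value_def generated[OF t])
    then have V: "strategy_value \<psi> \<mu> t = G (z t) * exp (h t)"
      using strategy_value_mult_generated[OF t one] by simp
    then show "strategy_value \<psi> \<mu> t =
        G (\<mu> t, A t) * exp (stieltjes_integral (\<lambda>s. 1 / G (\<mu> s, A s)) (Gamma_proc P \<mu> A G) t)"
      by (simp add: h_def z_def)
    \<comment> \<open>The exponential is positive, so the sign of the value is that of
      \<open>G\<close>, which does not change along the path.\<close>
    show "0 < strategy_value \<psi> \<mu> t" if "0 < G (\<mu> 0, A 0)"
      using Gz_pos[OF t] that by (simp add: V z_def)
    show "\<psi> t $ i = strategy_value \<psi> \<mu> t * (1 + 1 / G (\<mu> t, A t) *
        (partial_x i G (\<mu> t, A t) - (\<Sum>j\<in>UNIV. \<mu> t $ j * partial_x j G (\<mu> t, A t))))" for i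
      using mult_generated_component[OF t one, of i] unfolding V generated[OF t] z_def .
  qed
qed

end
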